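(* Let $(A,\Lambda)$ be any associative form ring and $n\ge 3$. Then for any two comaximal form ideals $(I,\Gamma)$ and $(J,\Delta)$ of $(A,\Lambda)$, i.e. with $I+J=A$, one has $$[\operatorname{EU}(2n,I,\Gamma),\operatorname{EU}(2n,J,\Delta)]=\operatorname{EU}(2n,(I,\Gamma)\circ(J,\Delta)).$$
   Context: Form rings. $A$ is an associative ring with $1$ with an involution $a\mapsto\bar a$ (additive, $\overline{ab}=\bar b\,\bar a$, $\bar{\bar a}=a$), and $\lambda\in\operatorname{Cent}(A)$ is fixed with $\lambda\bar\lambda=1$. Put $\Lambda_{\min}=\{c-\lambda\bar c\mid c\in A\}$, $\Lambda_{\max}=\{c\in A\mid c=-\lambda\bar c\}$. A form parameter $\Lambda$ is an additive subgroup with $\Lambda_{\min}\subseteq\Lambda\subseteq\Lambda_{\max}$ and $c\Lambda\bar c\subseteq\Lambda$ for all $c\in A$; then $(A,\Lambda)$ is a form ring. Form ideals. For a two-sided ideal $I$ with $\bar I=I$ put $\Gamma_{\max}(I)=I\cap\Lambda$ and $\Gamma_{\min}(I)=\{a-\lambda\bar a\mid a\in I\}+\langle ac\bar a\mid a\in I,c\in\Lambda\rangle$ ($\langle\cdot\rangle$ = additive subgroup generated). A form ideal $(I,\Gamma)$ consists of such an $I$ and an additive subgroup $\Gamma$ with $\Gamma_{\min}(I)\subseteq\Gamma\subseteq\Gamma_{\max}(I)$ and $c\Gamma\bar c\subseteq\Gamma$ for all $c\in A$. The symmetrised product is $(I,\Gamma)\circ(J,\Delta)=(IJ+JI,\ \Gamma_{\min}(IJ+JI)+{}^J\Gamma+{}^I\Delta)$,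 where ${}^J\Gamma=\langle b\gamma\bar b\mid b\in J,\gamma\in\Gamma\rangle$, ${}^I\Delta=\langle a\delta\bar a\mid a\in I,\delta\in\Delta\rangle$. Elementary subgroups. $\Omega=\{1,\dots,n,-n,\dots,-1\}$ indexes rows and columns of $2n\times 2n$ matrices; $\varepsilon(i)$ is the sign of $i$. For $i\ne\pm j$, $c\in A$: $T_{ij}(c)=e+ce_{ij}-\lambda^{(\varepsilon(j)-\varepsilon(i))/2}\bar c\,e_{-j,-i}$. For $c\in\lambda^{-(\varepsilon(i)+1)/2}\Lambda$: $T_{i,-i}(c)=e+ce_{i,-i}$. For a form ideal write $(I,\Gamma)_{ij}=I$ if $i\ne\pm j$ and $(I,\Gamma)_{i,-i}=\lambda^{-(\varepsilon(i)+1)/2}\Gamma$. $\operatorname{EU}(2n,A,\Lambda)$ is generated by all $T_{ij}(c)$, $c\in(A,\Lambda)_{ij}$; $\operatorname{EU}(2n,I,\Gamma)$ is the normal closure in $\operatorname{EU}(2n,A,\Lambda)$ of the subgroup generated by all $T_{ij}(a)$, $a\in(I,\Gamma)_{ij}$. Here $[x,y]=xyx^{-1}y^{-1}$ and $[H,K]$ is the subgroup generated by commutators. *)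

theory Defs
  imports
    "HOL-Algebra.Generated_Groups"
    "HOL-Computational_Algebra.Group_Closure"
    "HOL-Library.Set_Algebras"
begin

text \<open>
  The sort \<open>{ring, monoid_mult}\<close> is that of associative rings with 1. Unlike \<open>ring_1\<close> it does
  not require \<open>0 \<noteq> 1\<close>. On sets, \<open>+\<close> and \<open>*\<close> are the elementwise operations of \<open>Set_Algebras\<close>, and
  \<open>group_closure S\<close> is the additive subgroup generated by \<open>S\<close>.
\<close>

subsection \<open>Form rings and form ideals\<close>

definition add_subgroup :: "'a::ab_group_add set \<Rightarrow> bool" where
  "add_subgroup H \<longleftrightarrow> 0 \<in> H \<and> (\<forall>x\<in>H. \<forall>y\<in>H. x + y \<in> H) \<and> (\<forall>x\<in>H. - x \<in> H)"

definition two_sided_ideal :: "'a::ring set \<Rightarrow> bool" where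
  "two_sided_ideal I \<longleftrightarrow> add_subgroup I \<and> (\<forall>a. \<forall>x\<in>I. a * x \<in> I \<and> x * a \<in> I)"

definition Lambda_min :: "('a::{ring,monoid_mult} \<Rightarrow> 'a) \<Rightarrow> 'a \<Rightarrow> 'a set" where
  "Lambda_min bar lam = {c - lam * bar c | c. True}"

definition Lambda_max :: "('a::{ring,monoid_mult} \<Rightarrow> 'a) \<Rightarrow> 'a \<Rightarrow> 'a set" where
  "Lambda_max bar lam = {c. c = - (lam * bar c)}"

locale form_ring =
  fixes bar :: "'a::{ring,monoid_mult} \<Rightarrow> 'a"
    and lam :: 'a
    and \<Lambda> :: "'a set"
  assumes bar_add: "bar (a + b) = bar a + bar b"
    and bar_mult: "bar (a * b) = bar b * bar a"
    and bar_bar: "bar (bar a) = a"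
    and lam_central: "lam * a = a * lam"
    and lam_bar_lam: "lam * bar lam = 1"
    and add_subgroup_Lambda: "add_subgroup \<Lambda>"
    and Lambda_min_subset: "Lambda_min bar lam \<subseteq> \<Lambda>"
    and Lambda_subset_max: "\<Lambda> \<subseteq> Lambda_max bar lam"
    and Lambda_conj: "x \<in> \<Lambda> \<Longrightarrow> c * x * bar c \<in> \<Lambda>"

definition Gamma_max :: "'a::{ring,monoid_mult} set \<Rightarrow> 'a set \<Rightarrow> 'a set" where
  "Gamma_max \<Lambda> I = I \<inter> \<Lambda>"

text \<open>
  \<open>form_act bar J \<Gamma>\<close> is the additive subgroup generated by all \<open>b \<gamma> bar b\<close> with \<open>b \<in> J\<close>
  and \<open>\<gamma> \<in> \<Gamma>\<close>, written with \<open>J\<close> as a left superscript of \<open>\<Gamma>\<close>.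
\<close>

definition form_act :: "('a::{ring,monoid_mult} \<Rightarrow> 'a) \<Rightarrow> 'a set \<Rightarrow> 'a set \<Rightarrow> 'a set" where
  "form_act bar J \<Gamma> = group_closure {b * g * bar b | b g. b \<in> J \<and> g \<in> \<Gamma>}"

definition Gamma_min ::
    "('a::{ring,monoid_mult} \<Rightarrow> 'a) \<Rightarrow> 'a \<Rightarrow> 'a set \<Rightarrow> 'a set \<Rightarrow> 'a set" where
  "Gamma_min bar lam \<Lambda> I = {a - lam * bar a | a. a \<in> I} + form_act bar I \<Lambda>"

definition form_ideal ::
    "('a::{ring,monoid_mult} \<Rightarrow> 'a) \<Rightarrow> 'a \<Rightarrow> 'a set \<Rightarrow> 'a set \<times> 'a set \<Rightarrow> bool" where
  "form_ideal bar lam \<Lambda> = (\<lambda>(I, \<Gamma>).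
     two_sided_ideal I \<and> bar ` I = I \<and>
     add_subgroup \<Gamma> \<and> Gamma_min bar lam \<Lambda> I \<subseteq> \<Gamma> \<and> \<Gamma> \<subseteq> Gamma_max \<Lambda> I \<and>
     (\<forall>c. \<forall>g\<in>\<Gamma>. c * g * bar c \<in> \<Gamma>))"

definition ideal_mult :: "'a::ring set \<Rightarrow> 'a set \<Rightarrow> 'a set" where
  "ideal_mult I J = group_closure (I * J)"

definition symm_prod ::
    "('a::{ring,monoid_mult} \<Rightarrow> 'a) \<Rightarrow> 'a \<Rightarrow> 'a set \<Rightarrow> 'a set \<times> 'a set \<Rightarrow> 'a set \<times> 'a set
      \<Rightarrow> 'a set \<times> 'a set" where
  "symm_prod bar lam \<Lambda> = (\<lambda>(I, \<Gamma>) (J, \<Delta>).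
     (ideal_mult I J + ideal_mult J I,
      Gamma_min bar lam \<Lambda> (ideal_mult I J + ideal_mult J I) + form_act bar J \<Gamma> + form_act bar I \<Delta>))"

subsection \<open>The general linear group of degree \<open>2n\<close>\<close>

definition Omega :: "nat \<Rightarrow> int set" where
  "Omega n = {1..int n} \<union> {- int n..- 1}"

text \<open>Matrices indexed by \<open>Omega n\<close> are functions that vanish outside \<open>Omega n \<times> Omega n\<close>.\<close>

type_synonym 'a matr = "int \<Rightarrow> int \<Rightarrow> 'a"

definition unit_matr :: "nat \<Rightarrow> 'a::{ring,monoid_mult} matr" where
  "unit_matr n = (\<lambda>i j. if i \<in> Omega n \<and> i = j then 1 else 0)"

definition matr_mult :: "nat \<Rightarrow> 'a::{ring,monoid_mult} matr \<Rightarrow> 'a matr \<Rightarrow> 'a matr" where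
  "matr_mult n x y = (\<lambda>i k. \<Sum>j\<in>Omega n. x i j * y j k)"

definition matr_monoid :: "nat \<Rightarrow> 'a::{ring,monoid_mult} matr monoid" where
  "matr_monoid n =
     \<lparr>carrier = {x. \<forall>i j. i \<notin> Omega n \<or> j \<notin> Omega n \<longrightarrow> x i j = 0},
      mult = matr_mult n,
      one = unit_matr n\<rparr>"

definition GL :: "nat \<Rightarrow> 'a::{ring,monoid_mult} matr monoid" where
  "GL n = units_of (matr_monoid n)"

subsection \<open>Elementary unitary groups\<close>

text \<open>Integer powers of \<open>lam\<close>; in a form ring the inverse of \<open>lam\<close> is \<open>bar lam\<close>.\<close>

definition lam_pow :: "('a::{ring,monoid_mult} \<Rightarrow> 'a) \<Rightarrow> 'a \<Rightarrow> int \<Rightarrow> 'a" where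
  "lam_pow bar lam k = (if k \<ge> 0 then lam ^ nat k else bar lam ^ nat (- k))"

text \<open>The matrix with the entry \<open>c\<close> in position \<open>(i, j)\<close> and zeros elsewhere.\<close>

definition matr_entry :: "'a::{ring,monoid_mult} \<Rightarrow> int \<Rightarrow> int \<Rightarrow> 'a matr" where
  "matr_entry c i j = (\<lambda>k l. if k = i \<and> l = j then c else 0)"

text \<open>The divisions by 2 below are exact, as \<open>sgn i\<close> and \<open>sgn j\<close> are \<open>1\<close> or \<open>-1\<close>.\<close>

definition transv ::
    "('a::{ring,monoid_mult} \<Rightarrow> 'a) \<Rightarrow> 'a \<Rightarrow> nat \<Rightarrow> int \<Rightarrow> int \<Rightarrow> 'a \<Rightarrow> 'a matr" where
  "transv bar lam n i j c =
     (if j = - i then (\<lambda>k l. unit_matr n k l + matr_entry c i (- i) k l)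
      else (\<lambda>k l. unit_matr n k l + matr_entry c i j k l
              - matr_entry (lam_pow bar lam ((sgn j - sgn i) div 2) * bar c) (- j) (- i) k l))"

definition entry_set ::
    "('a::{ring,monoid_mult} \<Rightarrow> 'a) \<Rightarrow> 'a \<Rightarrow> 'a set \<times> 'a set \<Rightarrow> int \<Rightarrow> int \<Rightarrow> 'a set" where
  "entry_set bar lam = (\<lambda>(I, \<Gamma>) i j.
     if j = - i then (\<lambda>g. lam_pow bar lam (- ((sgn i + 1) div 2)) * g) ` \<Gamma> else I)"

definition elem_gens ::
    "('a::{ring,monoid_mult} \<Rightarrow> 'a) \<Rightarrow> 'a \<Rightarrow> nat \<Rightarrow> 'a set \<times> 'a set \<Rightarrow> 'a matr set" where
  "elem_gens bar lam n F =
     {transv bar lam n i j c | i j c.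
        i \<in> Omega n \<and> j \<in> Omega n \<and> i \<noteq> j \<and> c \<in> entry_set bar lam F i j}"

definition normal_closure :: "('g, 'm) monoid_scheme \<Rightarrow> 'g set \<Rightarrow> 'g set \<Rightarrow> 'g set" where
  "normal_closure G E H = \<Inter> {N. N \<lhd> (G\<lparr>carrier := E\<rparr>) \<and> H \<subseteq> N}"

definition commutator_subgroup :: "('g, 'm) monoid_scheme \<Rightarrow> 'g set \<Rightarrow> 'g set \<Rightarrow> 'g set" where
  "commutator_subgroup G H K =
     generate G {x \<otimes>\<^bsub>G\<^esub> y \<otimes>\<^bsub>G\<^esub> inv\<^bsub>G\<^esub> x \<otimes>\<^bsub>G\<^esub> inv\<^bsub>G\<^esub> y | x y. x \<in> H \<and> y \<in> K}"

definition EU_abs ::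
    "('a::{ring,monoid_mult} \<Rightarrow> 'a) \<Rightarrow> 'a \<Rightarrow> 'a set \<Rightarrow> nat \<Rightarrow> 'a matr set" where
  "EU_abs bar lam \<Lambda> n = generate (GL n) (elem_gens bar lam n (UNIV, \<Lambda>))"

definition EU ::
    "('a::{ring,monoid_mult} \<Rightarrow> 'a) \<Rightarrow> 'a \<Rightarrow> 'a set \<Rightarrow> nat \<Rightarrow> 'a set \<times> 'a set \<Rightarrow> 'a matr set" where
  "EU bar lam \<Lambda> n F =
     normal_closure (GL n) (EU_abs bar lam \<Lambda> n) (generate (GL n) (elem_gens bar lam n F))"

end

theory Submission
  imports Defs
begin

text \<open>
  \<^bold>\<open>Reduction to generators.\<close> Write \<open>E\<close> for the elementary group of \<open>(A, \<Lambda>)\<close>, and \<open>X\<close>, \<open>Y\<close>, \<open>Z\<close> for the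
  elementary transvections belonging to the form ideals \<open>(I, \<Gamma>)\<close>, \<open>(J, \<Delta>)\<close> and their symmetrised product.
  The point is that for every normal subgroup \<open>N\<close> of \<open>E\<close>

  \<^item> \<open>Z \<subseteq> N\<close> if and only if every element of \<open>X\<close> commutes modulo \<open>N\<close> with every element of \<open>Y\<close>.

  Taking for \<open>N\<close> the commutator subgroup gives one inclusion of the theorem, and taking for \<open>N\<close> the
  normal closure of \<open>Z\<close> gives the other (\<open>commutator_normal_closures_eq\<close>). The second step has to pass
  from generators to normal closures. This is possible because comaximality makes \<open>X \<union> Y\<close> generate
  \<open>E\<close> (\<open>generate_comaximal\<close>): modulo \<open>N\<close> the group \<open>E\<close> is then a product of two commuting subgroups,
  generated by \<open>X\<close> and by \<open>Y\<close>, which are therefore already normal. No conjugates of generators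
  have to be considered.

  \<^bold>\<open>The equivalence.\<close> If \<open>X\<close> and \<open>Y\<close> commute modulo \<open>N\<close>, the commutator formulas exhibit the transvections
  with parameters \<open>a b\<close>, \<open>b a\<close>, \<open>b \<gamma> bar b\<close> and \<open>a \<delta> bar a\<close> as elements of \<open>N\<close>, and normality of \<open>N\<close>
  supplies the rest of \<open>Z\<close> (\<open>gens_commute_absorbs\<close>, \<open>symm_prod_gens_subset_iff\<close>). Conversely, if \<open>Z \<subseteq> N\<close>, the
  same formulas show that two transvections from \<open>X\<close> and \<open>Y\<close> commute modulo \<open>N\<close> unless their roots are
  opposite. For opposite roots one writes \<open>1 = p + q\<close> with \<open>p \<in> I\<close> and \<open>q \<in> J\<close>; up to factors in \<open>N\<close>
  this allows the parameter \<open>a\<close> to be replaced by \<open>a p\<close>, or \<open>g\<close> by \<open>p g bar p\<close> for long roots. Such a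
  transvection is a product of transvections for roots that are not opposite to the given one, with
  parameters still in \<open>I\<close> (\<open>commute_short_opposite\<close>, \<open>commute_long_opposite\<close>).

  The root of \<open>T i j c\<close> is \<open>(i, j)\<close>, identified with \<open>(-j, -i)\<close>; its opposite is \<open>(j, i)\<close>. It is called short
  if \<open>i \<noteq> -j\<close> and long if \<open>i = -j\<close>.
\<close>

section \<open>Transvections and their commutator formulas\<close>

lemma finite_Omega [simp]: "finite (Omega n)"
  by (simp add: Omega_def)

lemma Omega_uminus [simp]: "- i \<in> Omega n \<longleftrightarrow> i \<in> Omega n"
  by (auto simp: Omega_def)

lemma Omega_nonzero: "i \<in> Omega n \<Longrightarrow> i \<noteq> 0"
  by (auto simp: Omega_def)

lemma carrier_matr_monoid:
  "x \<in> carrier (matr_monoid n) \<longleftrightarrow> (\<forall>i j. i \<notin> Omega n \<or> j \<notin> Omega n \<longrightarrow> x i j = 0)"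
  by (simp add: matr_monoid_def)

lemma matr_monoid_simps [simp]:
  "mult (matr_monoid n) = matr_mult n" "one (matr_monoid n) = unit_matr n"
  by (simp_all add: matr_monoid_def)

lemma matr_mult_assoc:
  "matr_mult n (matr_mult n x y) z = matr_mult n x (matr_mult n y z)"
proof (rule ext, rule ext)
  fix i l
  have "matr_mult n (matr_mult n x y) z i l = (\<Sum>k\<in>Omega n. \<Sum>j\<in>Omega n. x i j * y j k * z k l)"
    by (simp add: matr_mult_def sum_distrib_right)
  also have "\<dots> = (\<Sum>j\<in>Omega n. \<Sum>k\<in>Omega n. x i j * y j k * z k l)"
    by (rule sum.swap)
  also have "\<dots> = matr_mult n x (matr_mult n y z) i l"
    by (simp add: matr_mult_def sum_distrib_left mult.assoc)
  finally show "matr_mult n (matr_mult n x y) z i l = matr_mult n x (matr_mult n y z) i l" .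
qed

lemma monoid_matr: "monoid (matr_monoid n)"
proof (rule monoidI)
  fix x :: "'a matr" assume x: "x \<in> carrier (matr_monoid n)"
  have "(\<Sum>j\<in>Omega n. (if i \<in> Omega n \<and> i = j then 1 else 0) * x j k)
      = (\<Sum>j\<in>Omega n. if i = j then x j k else 0)" for i k
    by (rule sum.cong) auto
  then have "(\<Sum>j\<in>Omega n. (if i \<in> Omega n \<and> i = j then 1 else 0) * x j k) = x i k" for i k
    using x by (simp add: carrier_matr_monoid)
  then show "\<one>\<^bsub>matr_monoid n\<^esub> \<otimes>\<^bsub>matr_monoid n\<^esub> x = x"
    by (simp add: matr_mult_def unit_matr_def)
  have "(\<Sum>j\<in>Omega n. x i j * (if j \<in> Omega n \<and> j = k then 1 else 0))
      = (\<Sum>j\<in>Omega n. if j = k then x i j else 0)" for i k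
    by (rule sum.cong) auto
  then have "(\<Sum>j\<in>Omega n. x i j * (if j \<in> Omega n \<and> j = k then 1 else 0)) = x i k" for i k
    using x by (simp add: carrier_matr_monoid)
  then show "x \<otimes>\<^bsub>matr_monoid n\<^esub> \<one>\<^bsub>matr_monoid n\<^esub> = x"
    by (simp add: matr_mult_def unit_matr_def)
qed (simp_all add: matr_mult_assoc, auto simp: carrier_matr_monoid matr_mult_def unit_matr_def)

lemma group_GL: "group (GL n)"
  unfolding GL_def by (rule monoid.units_group[OF monoid_matr])

lemma mult_GL [simp]: "mult (GL n) = matr_mult n"
  by (simp add: GL_def units_of_def)

lemma one_GL [simp]: "one (GL n) = unit_matr n"
  by (simp add: GL_def units_of_def)

text \<open>
  Every transvection is the unit matrix plus at most two further entries, so it acts on the left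
  by at most two row operations. A relation between words in transvections is checked by letting
  both sides act on an arbitrary matrix, one entry at a time (lemma \<open>matr_eq_by_action\<close>), which
  avoids expanding products of matrices.
\<close>

definition elem_matr :: "nat \<Rightarrow> int \<Rightarrow> int \<Rightarrow> 'a::{ring,monoid_mult} \<Rightarrow> int \<Rightarrow> int \<Rightarrow> 'a \<Rightarrow> 'a matr" where
  "elem_matr n i j c k l d = (\<lambda>p q. unit_matr n p q + matr_entry c i j p q + matr_entry d k l p q)"

lemma matr_mult_elem:
  assumes "i \<in> Omega n" "j \<in> Omega n" "k \<in> Omega n" "l \<in> Omega n" "y \<in> carrier (matr_monoid n)"
  shows "matr_mult n (elem_matr n i j c k l d) y
    = (\<lambda>p q. y p q + (if p = i then c * y j q else 0) + (if p = k then d * y l q else 0))"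
proof (rule ext, rule ext)
  fix p q
  have "matr_mult n (unit_matr n) y p q = y p q"
    using monoid.l_one[OF monoid_matr assms(5)] by simp
  moreover have "(\<Sum>r\<in>Omega n. matr_entry c i j p r * y r q) = (if p = i then c * y j q else 0)"
    if j: "j \<in> Omega n" for c :: 'a and i j p
  proof -
    have "(\<Sum>r\<in>Omega n. matr_entry c i j p r * y r q)
      = (\<Sum>r\<in>Omega n. if j = r then (if p = i then c * y j q else 0) else 0)"
      by (rule sum.cong) (auto simp: matr_entry_def)
    then show ?thesis using j by simp
  qed
  ultimately show "matr_mult n (elem_matr n i j c k l d) y p q
    = y p q + (if p = i then c * y j q else 0) + (if p = k then d * y l q else 0)"
    using assms by (simp add: elem_matr_def matr_mult_def distrib_right sum.distrib)
qed

lemma elem_matr_carrier: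
  "\<lbrakk>i \<in> Omega n; j \<in> Omega n; k \<in> Omega n; l \<in> Omega n\<rbrakk>
    \<Longrightarrow> elem_matr n i j c k l d \<in> carrier (matr_monoid n)"
  by (auto simp: elem_matr_def carrier_matr_monoid unit_matr_def matr_entry_def)

lemma matr_mult_carrier:
  "\<lbrakk>x \<in> carrier (matr_monoid n); y \<in> carrier (matr_monoid n)\<rbrakk>
    \<Longrightarrow> matr_mult n x y \<in> carrier (matr_monoid n)"
  using monoid.m_closed[OF monoid_matr] by fastforce

context form_ring
begin

lemma bar_zero [simp]: "bar 0 = 0"
  using bar_add[of 0 0] by simp

lemma bar_minus: "bar (- a) = - bar a"
  using bar_add[of a "- a"] by (simp add: eq_neg_iff_add_eq_0 add.commute)

lemma bar_one [simp]: "bar 1 = 1"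
  using bar_mult[of 1 "bar 1"] bar_bar[of 1] by simp

lemma bar_lam_central: "bar lam * a = a * bar lam"
  using arg_cong[OF lam_central[of "bar a"], of bar] by (simp add: bar_mult bar_bar)

lemma bar_lam_lam: "bar lam * lam = 1"
  using lam_bar_lam lam_central by simp

text \<open>
  The exponents of \<open>lam\<close> in a transvection depend on the signs of its two indices. They are
  absorbed by giving each index \<open>i\<close> a weight of its own: with \<open>lamsgn i\<close> as below,
  \<open>lam_pow bar lam ((sgn j - sgn i) div 2)\<close> is \<open>lamsgn j * bar (lamsgn i)\<close> and
  \<open>lam_pow bar lam (- ((sgn i + 1) div 2))\<close> is \<open>bar (lamsgn i)\<close>.
\<close>

definition lamsgn :: "int \<Rightarrow> 'a" where
  "lamsgn i = (if i > 0 then lam else 1)"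

lemma lamsgn_central: "lamsgn i * a = a * lamsgn i"
  by (simp add: lamsgn_def lam_central)

lemma bar_lamsgn_central: "bar (lamsgn i) * a = a * bar (lamsgn i)"
  by (simp add: lamsgn_def bar_lam_central)

lemma lamsgn_bar: "lamsgn i * bar (lamsgn i) = 1"
  by (simp add: lamsgn_def lam_bar_lam)

lemma bar_lamsgn: "bar (lamsgn i) * lamsgn i = 1"
  by (simp add: lamsgn_def bar_lam_lam)

lemma lamsgn_cancel [simp]: "lamsgn i * (bar (lamsgn i) * x) = x" "bar (lamsgn i) * (lamsgn i * x) = x"
  by (simp_all add: lamsgn_bar bar_lamsgn mult.assoc[symmetric])

lemma lamsgn_uminus: "i \<noteq> 0 \<Longrightarrow> lamsgn i * lamsgn (- i) = lam"
  by (auto simp: lamsgn_def)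

text \<open>
  The entry in position \<open>(-j, -i)\<close> of a short transvection with entry \<open>c\<close> in position
  \<open>(i, j)\<close> is \<open>- twist i j c\<close>. That transvections are unitary is reflected by \<open>twist\<close> reversing
  products (\<open>twist_mult\<close>) and being an involution (\<open>twist_twist\<close>). The relations below rest on
  these rules alone, so that no case distinction on the signs of indices is needed.
\<close>

definition twist :: "int \<Rightarrow> int \<Rightarrow> 'a \<Rightarrow> 'a" where
  "twist i j c = lamsgn j * bar (lamsgn i) * bar c"

lemma twist_add: "twist i j (a + b) = twist i j a + twist i j b"
  by (simp add: twist_def bar_add distrib_left)

lemma twist_zero [simp]: "twist i j 0 = 0"
  by (simp add: twist_def)

lemma twist_minus: "twist i j (- a) = - twist i j a"
  by (simp add: twist_def bar_minus)

lemma twist_mult: "twist j k b * twist i j a = twist i k (a * b)"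
proof -
  have "twist j k b * twist i j a = lamsgn k * (bar (lamsgn j) * (bar b * lamsgn j) * bar (lamsgn i)) * bar a"
    by (simp add: twist_def mult.assoc)
  also have "bar b * lamsgn j = lamsgn j * bar b"
    by (rule lamsgn_central[symmetric])
  also have "lamsgn k * (bar (lamsgn j) * (lamsgn j * bar b) * bar (lamsgn i)) * bar a
    = lamsgn k * (bar b * bar (lamsgn i)) * bar a"
    by simp
  also have "bar b * bar (lamsgn i) = bar (lamsgn i) * bar b"
    by (rule bar_lamsgn_central[symmetric])
  finally show ?thesis by (simp add: twist_def bar_mult mult.assoc)
qed

lemma twist_mult_left: "twist j k b * (twist i j a * x) = twist i k (a * b) * x"
  by (simp add: mult.assoc[symmetric] twist_mult)

lemma twist_twist:
  assumes "i \<noteq> 0" "j \<noteq> 0"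
  shows "twist (- j) (- i) (twist i j c) = c"
proof -
  have "twist (- j) (- i) (twist i j c)
    = lamsgn (- i) * bar (lamsgn (- j)) * (c * lamsgn i * bar (lamsgn j))"
    by (simp add: twist_def bar_mult bar_bar mult.assoc)
  also have "c * lamsgn i * bar (lamsgn j) = lamsgn i * bar (lamsgn j) * c"
    by (metis lamsgn_central bar_lamsgn_central mult.assoc)
  also have "lamsgn (- i) * bar (lamsgn (- j)) * (lamsgn i * bar (lamsgn j) * c)
    = lamsgn (- i) * (bar (lamsgn (- j)) * lamsgn i) * bar (lamsgn j) * c"
    by (simp add: mult.assoc)
  also have "bar (lamsgn (- j)) * lamsgn i = lamsgn i * bar (lamsgn (- j))"
    by (rule lamsgn_central[symmetric])
  also have "lamsgn (- i) * (lamsgn i * bar (lamsgn (- j))) * bar (lamsgn j) * c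
     = (lamsgn (- i) * lamsgn (- (- i))) * bar (lamsgn j * lamsgn (- j)) * c"
    by (simp add: bar_mult mult.assoc)
  also have "\<dots> = c"
    using assms lamsgn_uminus[of "- i"] lamsgn_uminus[of j] by (simp add: lam_bar_lam)
  finally show ?thesis .
qed

lemma lam_pow_twist: "i \<noteq> 0 \<Longrightarrow> j \<noteq> 0 \<Longrightarrow> lam_pow bar lam ((sgn j - sgn i) div 2) * bar c = twist i j c"
  by (auto simp: lam_pow_def twist_def lamsgn_def sgn_if lam_bar_lam)

lemma lam_pow_long: "i \<noteq> 0 \<Longrightarrow> lam_pow bar lam (- ((sgn i + 1) div 2)) = bar (lamsgn i)"
  by (auto simp: lam_pow_def lamsgn_def sgn_if)

abbreviation T :: "nat \<Rightarrow> int \<Rightarrow> int \<Rightarrow> 'a \<Rightarrow> 'a matr" where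
  "T \<equiv> transv bar lam"

lemma transv_elem:
  assumes "i \<in> Omega n" "j \<in> Omega n"
  shows "T n i j c = elem_matr n i j c (- j) (- i) (if j = - i then 0 else - twist i j c)"
  using lam_pow_twist[of i j c] assms[THEN Omega_nonzero]
  by (auto simp: transv_def elem_matr_def fun_eq_iff matr_entry_def)

lemma transv_carrier:
  "i \<in> Omega n \<Longrightarrow> j \<in> Omega n \<Longrightarrow> T n i j c \<in> carrier (matr_monoid n)"
  by (simp add: transv_elem elem_matr_carrier)

lemma matr_mult_transv:
  assumes "i \<in> Omega n" "j \<in> Omega n" "y \<in> carrier (matr_monoid n)"
  shows "matr_mult n (T n i j c) y p q = y p q + (if p = i then c * y j q else 0)
     - (if j \<noteq> - i \<and> p = - j then twist i j c * y (- i) q else 0)"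
  using assms by (auto simp: transv_elem matr_mult_elem)

lemma unit_carrier: "unit_matr n \<in> carrier (matr_monoid n)"
  using monoid.one_closed[OF monoid_matr] by simp

lemma matr_eq_by_action:
  assumes "x \<in> carrier (matr_monoid n)" "x' \<in> carrier (matr_monoid n)"
    and "\<And>y. y \<in> carrier (matr_monoid n) \<Longrightarrow> matr_mult n x y = matr_mult n x' y"
  shows "x = x'"
  using assms(3)[OF unit_carrier] monoid.r_one[OF monoid_matr assms(1)] monoid.r_one[OF monoid_matr assms(2)]
  by simp

lemmas transv_action_simps = matr_mult_transv transv_carrier matr_mult_carrier fun_eq_iff

lemma transv_add:
  assumes "i \<in> Omega n" "j \<in> Omega n" "i \<noteq> j"
  shows "matr_mult n (T n i j a) (T n i j b) = T n i j (a + b)"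
  apply (rule matr_eq_by_action[of _ n])
    apply (simp_all only: matr_mult_assoc)
  using assms assms(1)[THEN Omega_nonzero] assms(2)[THEN Omega_nonzero]
  by (auto simp: transv_action_simps twist_add algebra_simps)

lemma transv_zero: "i \<in> Omega n \<Longrightarrow> j \<in> Omega n \<Longrightarrow> T n i j 0 = unit_matr n"
  by (auto simp: transv_elem elem_matr_def matr_entry_def fun_eq_iff)

lemma transv_flip:
  assumes "i \<in> Omega n" "j \<in> Omega n" "j \<noteq> - i"
  shows "T n i j a = T n (- j) (- i) (- twist i j a)"
  using assms twist_twist[of i j a] assms(1)[THEN Omega_nonzero] assms(2)[THEN Omega_nonzero]
  by (auto simp: transv_elem elem_matr_def fun_eq_iff twist_minus algebra_simps)

text \<open>
  The conditions on the indices say that neither of the two matrices moves a row from which the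
  other one reads.
\<close>

lemma transv_commute:
  assumes "i \<in> Omega n" "j \<in> Omega n" "k \<in> Omega n" "l \<in> Omega n"
    "j \<noteq> k" "j \<noteq> - l" "i \<noteq> - k" "i \<noteq> l"
  shows "matr_mult n (T n i j a) (T n k l b) = matr_mult n (T n k l b) (T n i j a)"
proof (rule matr_eq_by_action[of _ n])
  fix y :: "'a matr" assume y: "y \<in> carrier (matr_monoid n)"
  note act = matr_mult_transv[OF assms(1,2)] matr_mult_transv[OF assms(3,4)]
  \<comment> \<open>Keeps linear arithmetic from splitting on each of the many disequalities between indices.\<close>
  have fixed: "matr_mult n (T n k l b) y j q = y j q" "matr_mult n (T n k l b) y (- i) q = y (- i) q"
    "matr_mult n (T n i j a) y l q = y l q" "matr_mult n (T n i j a) y (- k) q = y (- k) q" for q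
    using assms y [[linarith_neq_limit = 0]] by (auto simp: matr_mult_transv)
  have "matr_mult n (T n k l b) y \<in> carrier (matr_monoid n)"
    "matr_mult n (T n i j a) y \<in> carrier (matr_monoid n)"
    using assms y by (simp_all add: matr_mult_carrier transv_carrier)
  note act' = act[OF this(1)] act[OF this(2)]
  show "matr_mult n (matr_mult n (T n i j a) (T n k l b)) y
      = matr_mult n (matr_mult n (T n k l b) (T n i j a)) y"
    unfolding matr_mult_assoc fun_eq_iff act'(1) act'(4)
    unfolding fixed unfolding act[OF y]
    by (intro allI) (simp only: algebra_simps)
qed (use assms in \<open>auto intro!: matr_mult_carrier transv_carrier\<close>)

text \<open>
  The three remaining relations are commutator formulas \<open>[x, y] = z\<close>, written as
  \<open>x y = z (y x)\<close> so that no inverses occur.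
\<close>

lemma transv_comm_short:
  assumes "i \<in> Omega n" "j \<in> Omega n" "k \<in> Omega n"
    "i \<noteq> j" "i \<noteq> - j" "j \<noteq> k" "j \<noteq> - k" "i \<noteq> k" "i \<noteq> - k"
  shows "matr_mult n (T n i j a) (T n j k b)
    = matr_mult n (T n i k (a * b)) (matr_mult n (T n j k b) (T n i j a))"
  apply (rule matr_eq_by_action[of _ n])
    apply (simp_all only: matr_mult_assoc)
  using assms assms(1-3)[THEN Omega_nonzero]
  by (auto simp: transv_action_simps twist_mult_left algebra_simps)

lemma transv_comm_long:
  assumes "i \<in> Omega n" "j \<in> Omega n" "i \<noteq> j" "i \<noteq> - j"
  shows "matr_mult n (T n i j a) (T n j (- i) b)
    = matr_mult n (T n i (- i) (a * b - twist i (- i) (a * b))) (matr_mult n (T n j (- i) b) (T n i j a))"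
  apply (rule matr_eq_by_action[of _ n])
    apply (simp_all only: matr_mult_assoc)
  using assms assms(1-2)[THEN Omega_nonzero]
  by (auto simp: transv_action_simps twist_mult_left algebra_simps)

text \<open>
  The only relation in which the long entry \<open>g\<close> has to be compatible with the involution: writing
  \<open>A\<close>, \<open>B\<close> for the two matrices minus the unit matrix, one has \<open>[1 + A, 1 + B] = 1 + A B - B A - A B A\<close>,
  and the hypothesis on \<open>g\<close> turns \<open>A B - B A\<close> into a short transvection.
\<close>

lemma transv_comm_short_long:
  assumes "i \<in> Omega n" "k \<in> Omega n" "i \<noteq> k" "i \<noteq> - k" "twist k (- k) g = - g"
  shows "matr_mult n (T n i k a) (T n k (- k) g)
    = matr_mult n (matr_mult n (T n i (- k) (a * g)) (T n i (- i) (a * g * twist i k a)))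
        (matr_mult n (T n k (- k) g) (T n i k a))" (is "?l = ?r")
proof (rule matr_eq_by_action[of _ n])
  have "twist i (- k) (a * g) * x = - (g * (twist i k a * x))" for x
    using twist_mult_left[of k "- k" g i a x] assms(5) by simp
  then show "matr_mult n ?l y = matr_mult n ?r y" if "y \<in> carrier (matr_monoid n)" for y
    unfolding matr_mult_assoc using that assms assms(1-2)[THEN Omega_nonzero]
    by (auto simp: transv_action_simps algebra_simps)
qed (use assms in \<open>auto intro!: matr_mult_carrier transv_carrier\<close>)

text \<open>
  The scaling makes the parameter of a long transvection range over the same set \<open>\<Gamma>\<close> for each
  index \<open>i\<close>.
\<close>

definition long_transv :: "nat \<Rightarrow> int \<Rightarrow> 'a \<Rightarrow> 'a matr" where
  "long_transv n i g = T n i (- i) (bar (lamsgn i) * g)"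

lemma twist_long: "i \<noteq> 0 \<Longrightarrow> twist i (- i) (bar (lamsgn i) * w) = bar (lamsgn i) * (lam * bar w)"
proof -
  assume "i \<noteq> 0"
  have "twist i (- i) (bar (lamsgn i) * w) = lamsgn (- i) * (bar (lamsgn i) * (bar w * lamsgn i))"
    by (simp add: twist_def bar_mult bar_bar mult.assoc)
  also have "bar w * lamsgn i = lamsgn i * bar w"
    by (rule lamsgn_central[symmetric])
  also have "lamsgn (- i) * (bar (lamsgn i) * (lamsgn i * bar w)) = lamsgn (- i) * bar w"
    by simp
  also have "\<dots> = bar (lamsgn i) * (lamsgn i * lamsgn (- i) * bar w)"
    by (simp add: mult.assoc)
  finally show ?thesis using \<open>i \<noteq> 0\<close> by (simp add: lamsgn_uminus)
qed

lemma Lambda_eq: "g \<in> \<Lambda> \<Longrightarrow> lam * bar g = - g"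
  using Lambda_subset_max by (force simp: Lambda_max_def eq_neg_iff_add_eq_0 neg_eq_iff_add_eq_0 add.commute)

lemma twist_long_Lambda:
  "i \<noteq> 0 \<Longrightarrow> g \<in> \<Lambda> \<Longrightarrow> twist i (- i) (bar (lamsgn i) * g) = - (bar (lamsgn i) * g)"
  by (simp add: twist_long Lambda_eq)

lemma conj_twist: "a * (bar (lamsgn k) * g) * twist i k a = bar (lamsgn i) * (a * g * bar a)"
proof -
  have "a * (bar (lamsgn k) * g) * twist i k a = a * (bar (lamsgn k) * (g * lamsgn k) * bar (lamsgn i) * bar a)"
    by (simp add: twist_def mult.assoc)
  also have "g * lamsgn k = lamsgn k * g"
    by (rule lamsgn_central[symmetric])
  also have "a * (bar (lamsgn k) * (lamsgn k * g) * bar (lamsgn i) * bar a) = a * g * bar (lamsgn i) * bar a"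
    by (simp add: mult.assoc)
  also have "\<dots> = bar (lamsgn i) * (a * g * bar a)"
    using bar_lamsgn_central[of i "a * g"] by (simp add: mult.assoc[symmetric])
  finally show ?thesis .
qed

end

section \<open>Commuting modulo a normal subgroup\<close>

lemma (in group) inv_mult_cancel: "x \<in> carrier G \<Longrightarrow> y \<in> carrier G \<Longrightarrow> inv x \<otimes> (x \<otimes> y) = y"
  by (metis inv_closed l_inv l_one m_assoc)

lemma (in group) subgroup_cancel_left:
  assumes "subgroup C G" "x \<in> C" "y \<in> carrier G" "x \<otimes> y \<in> C"
  shows "y \<in> C"
proof -
  have "x \<in> carrier G" using assms(1,2) by (rule subgroup.mem_carrier)
  then have "y = inv x \<otimes> (x \<otimes> y)" using assms(3) by (simp add: inv_mult_cancel)
  then show ?thesis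
    using subgroup.m_closed[OF assms(1) subgroup.m_inv_closed[OF assms(1,2)] assms(4)] by simp
qed

lemma (in group) subgroup_cancel_right:
  assumes "subgroup C G" "x \<in> carrier G" "y \<in> C" "x \<otimes> y \<in> C"
  shows "x \<in> C"
proof -
  have "y \<in> carrier G" using assms(1,3) by (rule subgroup.mem_carrier)
  then have "x = (x \<otimes> y) \<otimes> inv y" using assms(2) by (simp add: m_assoc)
  then show ?thesis
    using subgroup.m_closed[OF assms(1,4) subgroup.m_inv_closed[OF assms(1,3)]] by simp
qed

lemma (in group) normal_if_generators:
  assumes "subgroup C G" "X \<subseteq> carrier G" "generate G X = carrier G"
    and "\<And>x c. x \<in> X \<Longrightarrow> c \<in> C \<Longrightarrow> x \<otimes> c \<otimes> inv x \<in> C"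
    and "\<And>x c. x \<in> X \<Longrightarrow> c \<in> C \<Longrightarrow> inv x \<otimes> c \<otimes> x \<in> C"
  shows "C \<lhd> G"
  unfolding normal_inv_iff
proof (intro conjI ballI assms(1))
  fix g c assume "g \<in> carrier G" "c \<in> C"
  from this(1) have "g \<in> generate G X" using assms(3) by simp
  then show "g \<otimes> c \<otimes> inv g \<in> C" using \<open>c \<in> C\<close>
  proof (induction arbitrary: c)
    case one
    then show ?case using assms(1) subgroup.mem_carrier by fastforce
  next
    case (incl h)
    then show ?case using assms(4) by blast
  next
    case (inv h)
    then show ?case using assms(2,5) by (metis inv_inv subsetD)
  next
    case (eng h1 h2)
    have "h1 \<in> carrier G" "h2 \<in> carrier G" "c \<in> carrier G"
      using generate_in_carrier[OF assms(2)] subgroup.mem_carrier[OF assms(1)] eng by auto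
    then have "(h1 \<otimes> h2) \<otimes> c \<otimes> inv (h1 \<otimes> h2) = h1 \<otimes> (h2 \<otimes> c \<otimes> inv h2) \<otimes> inv h1"
      by (simp add: m_assoc inv_mult_group)
    then show ?case using eng by simp
  qed
qed

definition commute_mod :: "('g, 'm) monoid_scheme \<Rightarrow> 'g set \<Rightarrow> 'g \<Rightarrow> 'g \<Rightarrow> bool" where
  "commute_mod G N x y \<longleftrightarrow> N #>\<^bsub>G\<^esub> (x \<otimes>\<^bsub>G\<^esub> y) = N #>\<^bsub>G\<^esub> (y \<otimes>\<^bsub>G\<^esub> x)"

lemma commute_mod_sym: "commute_mod G N x y \<longleftrightarrow> commute_mod G N y x"
  by (auto simp: commute_mod_def)

definition centralizer_mod :: "('g, 'm) monoid_scheme \<Rightarrow> 'g set \<Rightarrow> 'g set \<Rightarrow> 'g set" where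
  "centralizer_mod G N S = {g \<in> carrier G. \<forall>s\<in>S. commute_mod G N g s}"

context normal
begin

lemma coset_eq_iff:
  assumes "x \<in> carrier G" "y \<in> carrier G"
  shows "H #> x = H #> y \<longleftrightarrow> x \<otimes> inv y \<in> H"
proof -
  have "H #> x = H #> y \<longleftrightarrow> x \<in> H #> y"
    using rcos_self[OF assms(1) subgroup_axioms] repr_independence[OF _ assms(2) subgroup_axioms] by auto
  then show ?thesis using rcos_module[OF is_group assms(2,1)] by simp
qed

lemma coset_mult: "x \<in> carrier G \<Longrightarrow> y \<in> carrier G \<Longrightarrow> H #> (x \<otimes> y) = (H #> x) \<otimes>\<^bsub>G Mod H\<^esub> (H #> y)"
  using r_coset_hom_Mod by (simp add: hom_def)

lemma commute_mod_iff:
  assumes "x \<in> carrier G" "y \<in> carrier G"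
  shows "commute_mod G H x y \<longleftrightarrow> x \<otimes> y \<otimes> inv x \<otimes> inv y \<in> H"
  using assms by (simp add: commute_mod_def coset_eq_iff inv_mult_group m_assoc)

text \<open>
  How commutator formulas are used: if \<open>[x, y] = z\<close>, then commuting modulo \<open>H\<close> and membership
  of \<open>z\<close> in \<open>H\<close> are the same thing.
\<close>

lemma commute_mod_iff_factor:
  assumes "x \<in> carrier G" "y \<in> carrier G" "z \<in> carrier G" "x \<otimes> y = z \<otimes> (y \<otimes> x)"
  shows "commute_mod G H x y \<longleftrightarrow> z \<in> H"
  using assms(1-3) by (simp add: commute_mod_def coset_eq_iff assms(4)) (simp add: m_assoc)

lemma commute_mod_member:
  assumes "z \<in> H" "s \<in> carrier G"
  shows "commute_mod G H z s"
proof (subst commute_mod_iff_factor)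
  show "z \<otimes> (s \<otimes> inv z \<otimes> inv s) \<in> H" using assms inv_op_closed2 by simp
  show "z \<otimes> s = z \<otimes> (s \<otimes> inv z \<otimes> inv s) \<otimes> (s \<otimes> z)"
    using assms by (simp add: m_assoc inv_mult_cancel)
qed (use assms in auto)

lemma centralizer_mod_sym:
  "S \<subseteq> carrier G \<Longrightarrow> S \<subseteq> centralizer_mod G H X \<Longrightarrow> X \<subseteq> carrier G \<Longrightarrow> X \<subseteq> centralizer_mod G H S"
  by (auto simp: centralizer_mod_def commute_mod_def)

lemma subgroup_centralizer_mod:
  assumes S: "S \<subseteq> carrier G"
  shows "subgroup (centralizer_mod G H S) G"
proof (rule subgroupI)
  interpret Q: group "G Mod H" by (rule factorgroup_is_group)
  show "centralizer_mod G H S \<subseteq> carrier G" by (auto simp: centralizer_mod_def commute_mod_def)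
  have "\<one> \<in> centralizer_mod G H S" using S by (auto simp: centralizer_mod_def commute_mod_def)
  then show "centralizer_mod G H S \<noteq> {}" by blast
  fix a assume a: "a \<in> centralizer_mod G H S"
  then have ac: "a \<in> carrier G" by (simp add: centralizer_mod_def commute_mod_def)
  have "H #> (inv a \<otimes> s) = H #> (s \<otimes> inv a)" if s: "s \<in> S" for s
  proof -
    have sc: "s \<in> carrier G" using s S by blast
    have "inv a \<otimes> s = inv a \<otimes> (s \<otimes> a) \<otimes> inv a" using ac sc by (simp add: m_assoc)
    then have "H #> (inv a \<otimes> s)
        = (H #> inv a) \<otimes>\<^bsub>G Mod H\<^esub> (H #> (s \<otimes> a)) \<otimes>\<^bsub>G Mod H\<^esub> (H #> inv a)"
      using ac sc by (simp only: coset_mult m_closed inv_closed)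
    also have "H #> (s \<otimes> a) = H #> (a \<otimes> s)"
      using a s by (simp add: centralizer_mod_def commute_mod_def)
    also have "(H #> inv a) \<otimes>\<^bsub>G Mod H\<^esub> \<dots> \<otimes>\<^bsub>G Mod H\<^esub> (H #> inv a)
        = H #> (inv a \<otimes> (a \<otimes> s) \<otimes> inv a)"
      using ac sc by (simp only: coset_mult m_closed inv_closed)
    also have "inv a \<otimes> (a \<otimes> s) \<otimes> inv a = s \<otimes> inv a" using ac sc by (simp add: m_assoc[symmetric])
    finally show ?thesis .
  qed
  then show "inv a \<in> centralizer_mod G H S" using ac by (simp add: centralizer_mod_def commute_mod_def)
  fix b assume b: "b \<in> centralizer_mod G H S"
  then have bc: "b \<in> carrier G" by (simp add: centralizer_mod_def commute_mod_def)
  have "H #> (a \<otimes> b \<otimes> s) = H #> (s \<otimes> (a \<otimes> b))" if s: "s \<in> S" for s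
  proof -
    have sc: "s \<in> carrier G" using s S by blast
    have "H #> (a \<otimes> b \<otimes> s) = (H #> a) \<otimes>\<^bsub>G Mod H\<^esub> (H #> (b \<otimes> s))"
      using ac bc sc by (simp only: m_assoc coset_mult m_closed)
    also have "\<dots> = (H #> a) \<otimes>\<^bsub>G Mod H\<^esub> (H #> (s \<otimes> b))"
      using b s by (simp add: centralizer_mod_def commute_mod_def)
    also have "\<dots> = (H #> (a \<otimes> s)) \<otimes>\<^bsub>G Mod H\<^esub> (H #> b)"
      using ac bc sc by (simp only: m_assoc coset_mult[symmetric] m_closed)
    also have "\<dots> = (H #> (s \<otimes> a)) \<otimes>\<^bsub>G Mod H\<^esub> (H #> b)"
      using a s by (simp add: centralizer_mod_def commute_mod_def)
    also have "\<dots> = H #> (s \<otimes> (a \<otimes> b))"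
      using ac bc sc by (simp only: m_assoc coset_mult[symmetric] m_closed)
    finally show ?thesis .
  qed
  then show "a \<otimes> b \<in> centralizer_mod G H S" using ac bc by (simp add: centralizer_mod_def commute_mod_def)
qed

lemma subset_centralizer_mod:
  assumes "S \<subseteq> carrier G"
  shows "H \<subseteq> centralizer_mod G H S"
  using assms commute_mod_member by (auto simp: centralizer_mod_def)

text \<open>
  An element that commutes modulo \<open>H\<close> with every element of \<open>C\<close> changes the elements of \<open>C\<close>, under
  conjugation, only by factors from \<open>H\<close>.
\<close>

lemma conj_in_subgroup:
  assumes "subgroup C G" "H \<subseteq> C" "x \<in> centralizer_mod G H C" "c \<in> C"
  shows "x \<otimes> c \<otimes> inv x \<in> C"
proof -
  have xc: "x \<in> carrier G" "c \<in> carrier G" using assms subgroup.mem_carrier by (auto simp: centralizer_mod_def commute_mod_def)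
  then have "x \<otimes> c \<otimes> inv x \<otimes> inv c \<in> H"
    using assms by (auto simp: commute_mod_iff[symmetric] centralizer_mod_def)
  then have "x \<otimes> c \<otimes> inv x \<otimes> inv c \<otimes> c \<in> C"
    using assms by (meson subgroup.m_closed subsetD)
  then show ?thesis using xc by (simp add: m_assoc)
qed

lemma centralizer_mod_normal:
  assumes "M \<lhd> G"
  shows "centralizer_mod G H M \<lhd> G"
  unfolding normal_inv_iff
proof (intro conjI ballI)
  interpret M: normal M G by fact
  show "subgroup (centralizer_mod G H M) G" by (rule subgroup_centralizer_mod) (rule M.subset)
  fix g c assume g: "g \<in> carrier G" and c: "c \<in> centralizer_mod G H M"
  then have cc: "c \<in> carrier G" by (simp add: centralizer_mod_def commute_mod_def)
  have "H #> (g \<otimes> c \<otimes> inv g \<otimes> s) = H #> (s \<otimes> (g \<otimes> c \<otimes> inv g))" if s: "s \<in> M" for s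
  proof -
    have sc: "s \<in> carrier G" using s M.subset by blast
    have s': "inv g \<otimes> s \<otimes> g \<in> M" using M.inv_op_closed1 g s by blast
    have "g \<otimes> c \<otimes> inv g \<otimes> s = g \<otimes> (c \<otimes> (inv g \<otimes> s \<otimes> g)) \<otimes> inv g"
      using g cc sc by (simp add: m_assoc)
    then have "H #> (g \<otimes> c \<otimes> inv g \<otimes> s) = (H #> g) \<otimes>\<^bsub>G Mod H\<^esub> (H #> (c \<otimes> (inv g \<otimes> s \<otimes> g))) \<otimes>\<^bsub>G Mod H\<^esub> (H #> inv g)"
      using g cc sc by (simp only: coset_mult m_closed inv_closed)
    also have "H #> (c \<otimes> (inv g \<otimes> s \<otimes> g)) = H #> (inv g \<otimes> s \<otimes> g \<otimes> c)"
      using c s' by (simp add: centralizer_mod_def commute_mod_def)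
    also have "(H #> g) \<otimes>\<^bsub>G Mod H\<^esub> \<dots> \<otimes>\<^bsub>G Mod H\<^esub> (H #> inv g) = H #> (g \<otimes> (inv g \<otimes> s \<otimes> g \<otimes> c) \<otimes> inv g)"
      using g cc sc by (simp only: coset_mult[symmetric] m_closed inv_closed)
    also have "g \<otimes> (inv g \<otimes> s \<otimes> g \<otimes> c) \<otimes> inv g = s \<otimes> (g \<otimes> c \<otimes> inv g)"
      using g cc sc by (simp add: m_assoc[symmetric])
    finally show ?thesis .
  qed
  then show "g \<otimes> c \<otimes> inv g \<in> centralizer_mod G H M" using g cc by (simp add: centralizer_mod_def commute_mod_def)
qed

end

text \<open>
  The constant \<open>normal_closure\<close> replaces the carrier of its group. Here the new carrier equals the
  old one; this is the shape that the group \<open>G\<lparr>carrier := E\<rparr>\<close> has in the applications.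
\<close>

lemma (in group)
  assumes "E = carrier G" "S \<subseteq> carrier G"
  shows normal_closure_normal: "normal_closure G E S \<lhd> G"
    and subset_normal_closure: "S \<subseteq> normal_closure G E S"
    and normal_closure_minimal: "N \<lhd> G \<Longrightarrow> S \<subseteq> N \<Longrightarrow> normal_closure G E S \<subseteq> N"
proof -
  have [simp]: "G\<lparr>carrier := E\<rparr> = G" using assms by simp
  have ne: "carrier G \<in> {N. N \<lhd> G \<and> S \<subseteq> N}" using normal_self assms by simp
  have "subgroup (\<Inter> {N. N \<lhd> G \<and> S \<subseteq> N}) G"
    by (rule subgroups_Inter) (use ne in \<open>auto simp: normal_inv_iff\<close>)
  then show "normal_closure G E S \<lhd> G"
    by (auto simp: normal_closure_def normal_inv_iff)
qed (use assms in \<open>auto simp: normal_closure_def\<close>)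

lemma (in group) commutator_subgroup_normal:
  assumes "M \<lhd> G" "N \<lhd> G"
  shows "commutator_subgroup G M N \<lhd> G"
  unfolding commutator_subgroup_def
proof (rule normal_generateI)
  interpret M: normal M G by fact
  interpret N: normal N G by fact
  show "{x \<otimes> y \<otimes> inv x \<otimes> inv y | x y. x \<in> M \<and> y \<in> N} \<subseteq> carrier G"
    by auto
  fix h g assume "h \<in> {x \<otimes> y \<otimes> inv x \<otimes> inv y | x y. x \<in> M \<and> y \<in> N}" and g: "g \<in> carrier G"
  then obtain x y where xy: "x \<in> M" "y \<in> N" and h: "h = x \<otimes> y \<otimes> inv x \<otimes> inv y" by blast
  have "g \<otimes> h \<otimes> inv g = (g \<otimes> x \<otimes> inv g) \<otimes> (g \<otimes> y \<otimes> inv g) \<otimes> inv (g \<otimes> x \<otimes> inv g) \<otimes> inv (g \<otimes> y \<otimes> inv g)"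
    using xy g by (simp add: h m_assoc inv_mult_group inv_mult_cancel)
  then show "g \<otimes> h \<otimes> inv g \<in> {x \<otimes> y \<otimes> inv x \<otimes> inv y | x y. x \<in> M \<and> y \<in> N}"
    using M.inv_op_closed2[OF g xy(1)] N.inv_op_closed2[OF g xy(2)] by blast
qed

text \<open>
  It is enough that generators commute modulo \<open>N\<close>, provided that \<open>X \<union> Y\<close> generates the whole group:
  then the centralizer \<open>C\<close> of \<open>Y\<close> modulo \<open>N\<close> is normal, since \<open>X\<close> lies in \<open>C\<close> while \<open>Y\<close> commutes
  with \<open>C\<close> modulo \<open>N \<subseteq> C\<close>. Hence \<open>C\<close> contains the normal closure of \<open>X\<close>. The centralizer of
  that normal closure is normal anyway and contains \<open>Y\<close>, hence the normal closure of \<open>Y\<close>.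
\<close>

lemma (in group) commutator_normal_closures_subset:
  assumes "E = carrier G" "X \<subseteq> carrier G" "Y \<subseteq> carrier G" "generate G (X \<union> Y) = carrier G" "N \<lhd> G"
    and XY: "X \<subseteq> centralizer_mod G N Y"
  shows "commutator_subgroup G (normal_closure G E X) (normal_closure G E Y) \<subseteq> N"
proof -
  interpret N: normal N G by fact
  have conj: "x \<otimes> c \<otimes> inv x \<in> centralizer_mod G N Y"
    if "x \<in> X \<union> Y \<or> inv x \<in> X \<union> Y" "x \<in> carrier G" "c \<in> centralizer_mod G N Y" for x c
  proof -
    let ?C = "centralizer_mod G N Y"
    interpret C: subgroup ?C G by (rule N.subgroup_centralizer_mod) fact
    have ?thesis if "x \<in> ?C" using that \<open>c \<in> ?C\<close> by simp
    moreover have ?thesis if "x \<in> centralizer_mod G N ?C"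
      using that \<open>c \<in> ?C\<close> N.conj_in_subgroup N.subset_centralizer_mod assms(3) C.subgroup_axioms by blast
    moreover have "x \<in> ?C" if "x \<in> X \<or> inv x \<in> X"
      using that XY C.m_inv_closed[of "inv x"] \<open>x \<in> carrier G\<close> by auto
    moreover have "x \<in> centralizer_mod G N ?C" if "x \<in> Y \<or> inv x \<in> Y"
    proof -
      interpret CC: subgroup "centralizer_mod G N ?C" G
        by (rule N.subgroup_centralizer_mod) (rule C.subset)
      have "Y \<subseteq> centralizer_mod G N ?C" by (rule N.centralizer_mod_sym[OF C.subset subset_refl assms(3)])
      then show ?thesis using that CC.m_inv_closed[of "inv x"] \<open>x \<in> carrier G\<close> by auto
    qed
    ultimately show ?thesis using that(1) by blast
  qed
  have "centralizer_mod G N Y \<lhd> G"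
  proof (rule normal_if_generators[of _ "X \<union> Y"])
    show "inv x \<otimes> c \<otimes> x \<in> centralizer_mod G N Y" if "x \<in> X \<union> Y" "c \<in> centralizer_mod G N Y" for x c
      using conj[of "inv x" c] that assms(2,3) inv_inv[of x] inv_closed[of x] by (metis Un_iff subsetD)
    show "x \<otimes> c \<otimes> inv x \<in> centralizer_mod G N Y" if "x \<in> X \<union> Y" "c \<in> centralizer_mod G N Y" for x c
      using conj[of x c] that assms(2,3) by blast
    show "subgroup (centralizer_mod G N Y) G"
      by (rule N.subgroup_centralizer_mod) fact
  qed (use assms(2-4) in simp_all)
  then have "normal_closure G E X \<subseteq> centralizer_mod G N Y"
    using normal_closure_minimal assms by blast
  moreover have nX: "normal_closure G E X \<lhd> G" using normal_closure_normal assms by blast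
  then have sX: "normal_closure G E X \<subseteq> carrier G" by (rule normal_imp_subgroup[THEN subgroup.subset])
  ultimately have "Y \<subseteq> centralizer_mod G N (normal_closure G E X)"
    using N.centralizer_mod_sym assms(3) by blast
  then have Y: "normal_closure G E Y \<subseteq> centralizer_mod G N (normal_closure G E X)"
    using normal_closure_minimal[OF assms(1,3)] N.centralizer_mod_normal[OF nX] by blast
  have "x \<otimes> y \<otimes> inv x \<otimes> inv y \<in> N" if "x \<in> normal_closure G E X" "y \<in> normal_closure G E Y" for x y
    using that Y sX by (subst N.commute_mod_iff[symmetric]) (auto simp: centralizer_mod_def commute_mod_sym[of G N x])
  then show ?thesis
    unfolding commutator_subgroup_def
    by (intro generate_subgroup_incl N.subgroup_axioms) auto
qed

lemma (in group) commutator_subgroup_restrict: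
  assumes "subgroup E G" "M \<subseteq> E" "N \<subseteq> E"
  shows "commutator_subgroup (G\<lparr>carrier := E\<rparr>) M N = commutator_subgroup G M N"
proof -
  have "{x \<otimes> y \<otimes> inv\<^bsub>G\<lparr>carrier := E\<rparr>\<^esub> x \<otimes> inv\<^bsub>G\<lparr>carrier := E\<rparr>\<^esub> y | x y. x \<in> M \<and> y \<in> N}
      = {x \<otimes> y \<otimes> inv x \<otimes> inv y | x y. x \<in> M \<and> y \<in> N}" (is "?L = ?R")
  proof (intro Collect_cong ex_cong1)
    fix c x y
    show "c = x \<otimes> y \<otimes> inv\<^bsub>G\<lparr>carrier := E\<rparr>\<^esub> x \<otimes> inv\<^bsub>G\<lparr>carrier := E\<rparr>\<^esub> y \<and> x \<in> M \<and> y \<in> N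
      \<longleftrightarrow> c = x \<otimes> y \<otimes> inv x \<otimes> inv y \<and> x \<in> M \<and> y \<in> N"
      using m_inv_consistent[OF assms(1), of x] m_inv_consistent[OF assms(1), of y]
        subsetD[OF assms(2), of x] subsetD[OF assms(3), of y] by auto
  qed
  moreover have "?R \<subseteq> E"
    using subgroup.m_closed[OF assms(1)] subgroup.m_inv_closed[OF assms(1)] assms(2,3) by blast
  ultimately show ?thesis
    using generate_consistent[OF _ assms(1)] by (simp add: commutator_subgroup_def)
qed

text \<open>
  The normal closure of \<open>Z\<close> and the commutator of the normal closures of \<open>X\<close> and \<open>Y\<close> are compared
  by applying \<open>key\<close> twice. With \<open>N\<close> the normal closure of \<open>Z\<close> it yields that \<open>X\<close> and \<open>Y\<close>
  commute modulo \<open>N\<close>, so the commutator subgroup is contained in \<open>N\<close>; with \<open>N\<close> the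
  commutator subgroup it yields \<open>Z \<subseteq> N\<close>.
\<close>

lemma (in group) commutator_normal_closures_eq:
  assumes E: "subgroup E G" and sub: "X \<subseteq> E" "Y \<subseteq> E" "Z \<subseteq> E" and gen: "generate G (X \<union> Y) = E"
    and key: "\<And>N. N \<lhd> G\<lparr>carrier := E\<rparr>
      \<Longrightarrow> Z \<subseteq> N \<longleftrightarrow> (\<forall>x\<in>X. \<forall>y\<in>Y. commute_mod (G\<lparr>carrier := E\<rparr>) N x y)"
  shows "commutator_subgroup G (normal_closure G E (generate G X)) (normal_closure G E (generate G Y))
    = normal_closure G E (generate G Z)"
proof -
  let ?H = "G\<lparr>carrier := E\<rparr>"
  interpret H: group ?H by (rule subgroup_imp_group) (rule E)
  have car: "carrier ?H = E" by simp
  have gen_iff: "generate G S \<subseteq> N \<longleftrightarrow> S \<subseteq> N" if "N \<lhd> ?H" "S \<subseteq> E" for N S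
  proof -
    have "subgroup N ?H" using that normal_imp_subgroup by blast
    then show ?thesis
      using H.generate_subgroup_incl[of S N] generate.incl[of _ S G] generate_consistent[OF that(2) E] by auto
  qed
  have nc: "normal_closure G E (generate G S) = normal_closure ?H E S" if "S \<subseteq> E" for S
    using gen_iff[OF _ that] by (auto simp: normal_closure_def)
  have ncl: "normal_closure ?H E S \<lhd> ?H" if "S \<subseteq> E" for S
    using H.normal_closure_normal[of E S] that by simp
  then have ncE: "normal_closure ?H E S \<subseteq> E" if "S \<subseteq> E" for S
    using that normal_imp_subgroup subgroup.subset car by metis
  let ?X = "normal_closure ?H E X" and ?Y = "normal_closure ?H E Y" and ?Z = "normal_closure ?H E Z"
  let ?C = "commutator_subgroup ?H ?X ?Y"
  have XY: "X \<subseteq> ?X" "Y \<subseteq> ?Y" "Z \<subseteq> ?Z"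
    using H.subset_normal_closure[of E] sub by simp_all
  have "?C \<subseteq> ?Z"
  proof (rule H.commutator_normal_closures_subset)
    show "generate ?H (X \<union> Y) = carrier ?H" using generate_consistent[OF _ E, of "X \<union> Y"] sub gen by simp
    show "X \<subseteq> centralizer_mod ?H ?Z Y"
      using key[OF ncl[OF sub(3)]] XY sub by (auto simp: centralizer_mod_def)
  qed (use ncl sub in auto)
  moreover have "?Z \<subseteq> ?C"
  proof (rule H.normal_closure_minimal)
    have CN: "?C \<lhd> ?H" by (intro H.commutator_subgroup_normal ncl sub)
    then interpret C: normal ?C ?H .
    have "commute_mod ?H ?C x y" if "x \<in> X" "y \<in> Y" for x y
    proof -
      have "x \<otimes>\<^bsub>?H\<^esub> y \<otimes>\<^bsub>?H\<^esub> inv\<^bsub>?H\<^esub> x \<otimes>\<^bsub>?H\<^esub> inv\<^bsub>?H\<^esub> y \<in> ?C"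
        unfolding commutator_subgroup_def using that XY by (intro generate.incl) blast
      then show ?thesis using C.commute_mod_iff[of x y] that sub by auto
    qed
    then show "Z \<subseteq> ?C" using key[OF CN] by blast
    show "?C \<lhd> ?H" by (rule CN)
  qed (use sub in auto)
  ultimately have "?C = ?Z" by blast
  then show ?thesis
    using nc sub commutator_subgroup_restrict[OF E ncE ncE] by simp
qed

section \<open>The elementary unitary group\<close>

definition EU_group :: "('a::{ring,monoid_mult} \<Rightarrow> 'a) \<Rightarrow> 'a \<Rightarrow> 'a set \<Rightarrow> nat \<Rightarrow> 'a matr monoid" where
  "EU_group bar lam \<Lambda> n = (GL n)\<lparr>carrier := EU_abs bar lam \<Lambda> n\<rparr>"

lemma EU_group_simps [simp]:
  "carrier (EU_group bar lam \<Lambda> n) = EU_abs bar lam \<Lambda> n"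
  "mult (EU_group bar lam \<Lambda> n) = matr_mult n"
  "one (EU_group bar lam \<Lambda> n) = unit_matr n"
  by (simp_all add: EU_group_def)

context form_ring
begin

lemma transv_in_GL:
  assumes "i \<in> Omega n" "j \<in> Omega n" "i \<noteq> j"
  shows "T n i j c \<in> carrier (GL n)"
proof -
  have "matr_mult n (T n i j c) (T n i j (- c)) = unit_matr n"
    "matr_mult n (T n i j (- c)) (T n i j c) = unit_matr n"
    using assms by (simp_all add: transv_add transv_zero)
  moreover have "T n i j c \<in> carrier (matr_monoid n)" "T n i j (- c) \<in> carrier (matr_monoid n)"
    using assms by (simp_all add: transv_carrier)
  ultimately have "T n i j c \<in> Units (matr_monoid n)"
    unfolding Units_def by auto
  then show ?thesis by (simp add: GL_def units_of_def)
qed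

text \<open>
  The description of the generators that is used throughout: short transvections with entries in
  \<open>I\<close> and long ones with parameters in \<open>\<Gamma>\<close>.
\<close>

lemma elem_gens_eq:
  "elem_gens bar lam n (I, \<Gamma>)
    = {T n i j c | i j c. i \<in> Omega n \<and> j \<in> Omega n \<and> i \<noteq> j \<and> i \<noteq> - j \<and> c \<in> I}
      \<union> {long_transv n i g | i g. i \<in> Omega n \<and> g \<in> \<Gamma>}" (is "?L = ?S \<union> ?G")
proof
  have "T n i j c \<in> ?S \<union> ?G"
    if "i \<in> Omega n" "j \<in> Omega n" "i \<noteq> j" "c \<in> entry_set bar lam (I, \<Gamma>) i j" for i j c
  proof (cases "j = - i")
    case True
    then show ?thesis
      using that lam_pow_long[OF Omega_nonzero] by (auto simp: entry_set_def long_transv_def)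
  next
    case False
    then have "i \<noteq> - j" by auto
    moreover have "c \<in> I" using that False by (simp add: entry_set_def)
    ultimately show ?thesis using that by blast
  qed
  then show "?L \<subseteq> ?S \<union> ?G" unfolding elem_gens_def by blast
  show "?S \<union> ?G \<subseteq> ?L"
  proof (intro Un_least subsetI)
    fix x assume "x \<in> ?S"
    then obtain i j c where ijc: "x = T n i j c" "i \<in> Omega n" "j \<in> Omega n" "i \<noteq> j" "i \<noteq> - j" "c \<in> I"
      by blast
    then have "j \<noteq> - i" by auto
    then have "c \<in> entry_set bar lam (I, \<Gamma>) i j" using ijc by (simp add: entry_set_def)
    then show "x \<in> ?L" using ijc unfolding elem_gens_def by blast
  next
    fix x assume "x \<in> ?G"
    then obtain i g where ig: "x = long_transv n i g" "i \<in> Omega n" "g \<in> \<Gamma>" by blast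
    then have "bar (lamsgn i) * g \<in> entry_set bar lam (I, \<Gamma>) i (- i)"
      using lam_pow_long[OF Omega_nonzero] by (auto simp: entry_set_def)
    moreover have "i \<noteq> - i" using Omega_nonzero[OF ig(2)] by simp
    ultimately show "x \<in> ?L"
      using ig Omega_uminus[of i n] unfolding elem_gens_def long_transv_def by blast
  qed
qed

lemma elem_gens_in_GL: "elem_gens bar lam n F \<subseteq> carrier (GL n)"
  by (auto simp: elem_gens_def transv_in_GL)

lemma subgroup_EU_abs: "subgroup (EU_abs bar lam \<Lambda> n) (GL n)"
  unfolding EU_abs_def by (rule group.generate_is_subgroup[OF group_GL elem_gens_in_GL])

lemma group_EU: "group (EU_group bar lam \<Lambda> n)"
  unfolding EU_group_def by (rule subgroup.subgroup_is_group[OF subgroup_EU_abs group_GL])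

lemma elem_gens_subset_EU_abs:
  assumes "\<Gamma> \<subseteq> \<Lambda>"
  shows "elem_gens bar lam n (I, \<Gamma>) \<subseteq> EU_abs bar lam \<Lambda> n"
proof -
  have "elem_gens bar lam n (I, \<Gamma>) \<subseteq> elem_gens bar lam n (UNIV, \<Lambda>)"
    using assms unfolding elem_gens_eq by blast
  then show ?thesis unfolding EU_abs_def by (auto intro: generate.incl)
qed

lemma transv_in_EU:
  "i \<in> Omega n \<Longrightarrow> j \<in> Omega n \<Longrightarrow> i \<noteq> j \<Longrightarrow> i \<noteq> - j \<Longrightarrow> T n i j c \<in> EU_abs bar lam \<Lambda> n"
  by (rule subsetD[OF elem_gens_subset_EU_abs[OF order.refl, of n UNIV]]) (auto simp: elem_gens_eq; blast)

lemma long_transv_in_EU: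
  "i \<in> Omega n \<Longrightarrow> g \<in> \<Lambda> \<Longrightarrow> long_transv n i g \<in> EU_abs bar lam \<Lambda> n"
  by (rule subsetD[OF elem_gens_subset_EU_abs[OF order.refl, of n UNIV]]) (auto simp: elem_gens_eq; blast)

lemma long_transv_add:
  "i \<in> Omega n \<Longrightarrow> matr_mult n (long_transv n i g) (long_transv n i h) = long_transv n i (g + h)"
  using Omega_nonzero[of i n] by (simp add: long_transv_def transv_add distrib_left)

lemma Lambda_min_in: "c - lam * bar c \<in> \<Lambda>"
  using Lambda_min_subset by (auto simp: Lambda_min_def)

end

text \<open>
  The place where \<open>n \<ge> 3\<close> enters: every root can be written as a sum of two roots through an index
  that is unrelated to both of its own.
\<close>

lemma third_index:
  assumes "n \<ge> 3"
  obtains h where "h \<in> Omega n" "h \<noteq> i" "h \<noteq> - i" "h \<noteq> j" "h \<noteq> - j"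
proof -
  have "\<exists>h\<in>{1, 2, 3}. h \<noteq> \<bar>i\<bar> \<and> h \<noteq> \<bar>j\<bar>" by auto
  then obtain h where "h \<in> {1, 2, 3}" "h \<noteq> \<bar>i\<bar>" "h \<noteq> \<bar>j\<bar>" by blast
  then have "h \<in> Omega n" "h \<noteq> i" "h \<noteq> - i" "h \<noteq> j" "h \<noteq> - j"
    using assms by (auto simp: Omega_def)
  then show thesis by (rule that)
qed

section \<open>The level of a normal subgroup\<close>

locale EU_normal = form_ring bar lam \<Lambda> + normal N "EU_group bar lam \<Lambda> n"
  for bar :: "'a::{ring,monoid_mult} \<Rightarrow> 'a" and lam \<Lambda> N n +
  assumes n_ge_3: "n \<ge> 3"
begin

abbreviation G :: "'a matr monoid" where "G \<equiv> EU_group bar lam \<Lambda> n"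

abbreviation t :: "int \<Rightarrow> int \<Rightarrow> 'a \<Rightarrow> 'a matr" where "t \<equiv> T n"

abbreviation commutes :: "'a matr \<Rightarrow> 'a matr \<Rightarrow> bool" (infix "\<simeq>" 50) where
  "x \<simeq> y \<equiv> commute_mod G N x y"

text \<open>
  A normal subgroup \<open>N\<close> is tested by the parameters of the transvections that it contains. The
  commutator formulas turn normality into closure properties of these two sets: \<open>level\<close> is a
  two-sided ideal (\<open>add_subgroup_level\<close>, \<open>level_mult\<close>), and \<open>long_level\<close> is an additive subgroup that
  contains \<open>Gamma_min bar lam \<Lambda> level\<close> (\<open>add_subgroup_long_level\<close>, \<open>level_trace\<close>, \<open>level_conj\<close>).
\<close>

definition level :: "'a set" where
  "level = {c. \<forall>i\<in>Omega n. \<forall>j\<in>Omega n. i \<noteq> j \<longrightarrow> i \<noteq> - j \<longrightarrow> t i j c \<in> N}"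

definition long_level :: "'a set" where
  "long_level = {g \<in> \<Lambda>. \<forall>i\<in>Omega n. long_transv n i g \<in> N}"

lemma levelD: "c \<in> level \<Longrightarrow> i \<in> Omega n \<Longrightarrow> j \<in> Omega n \<Longrightarrow> i \<noteq> j \<Longrightarrow> i \<noteq> - j \<Longrightarrow> t i j c \<in> N"
  by (simp add: level_def)

lemma N_mult: "x \<in> N \<Longrightarrow> y \<in> N \<Longrightarrow> matr_mult n x y \<in> N"
  using subgroup.m_closed[OF subgroup_axioms] by simp

lemma N_left_cancel:
  assumes "x \<in> N" "y \<in> EU_abs bar lam \<Lambda> n"
  shows "matr_mult n x y \<in> N \<longleftrightarrow> y \<in> N"
  using subgroup_cancel_left[OF subgroup_axioms assms(1), of y] assms N_mult by auto

lemma elem_gens_subset_iff: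
  assumes "\<Gamma> \<subseteq> \<Lambda>"
  shows "elem_gens bar lam n (I, \<Gamma>) \<subseteq> N \<longleftrightarrow> I \<subseteq> level \<and> \<Gamma> \<subseteq> long_level"
proof
  assume X: "elem_gens bar lam n (I, \<Gamma>) \<subseteq> N"
  have "t i j c \<in> N" if "i \<in> Omega n" "j \<in> Omega n" "i \<noteq> j" "i \<noteq> - j" "c \<in> I" for i j c
    using that by (intro subsetD[OF X]) (auto simp: elem_gens_eq; blast)
  moreover have "long_transv n i g \<in> N" if "i \<in> Omega n" "g \<in> \<Gamma>" for i g
    using that by (intro subsetD[OF X]) (auto simp: elem_gens_eq; blast)
  ultimately show "I \<subseteq> level \<and> \<Gamma> \<subseteq> long_level"
    using assms by (auto simp: level_def long_level_def)
next
  assume "I \<subseteq> level \<and> \<Gamma> \<subseteq> long_level"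
  then show "elem_gens bar lam n (I, \<Gamma>) \<subseteq> N"
    by (auto simp: elem_gens_eq level_def long_level_def)
qed

lemma add_subgroup_transv:
  assumes "i \<in> Omega n" "j \<in> Omega n" "i \<noteq> j"
  shows "add_subgroup {c. t i j c \<in> N}"
  unfolding add_subgroup_def
proof (intro conjI ballI)
  show "0 \<in> {c. t i j c \<in> N}"
    using subgroup.one_closed[OF subgroup_axioms] assms by (simp add: transv_zero)
  fix x assume x: "x \<in> {c. t i j c \<in> N}"
  then have xN: "t i j x \<in> N" by simp
  have "inv\<^bsub>G\<^esub> (t i j x) = inv\<^bsub>GL n\<^esub> (t i j x)"
    unfolding EU_group_def
    using group.m_inv_consistent[OF group_GL subgroup_EU_abs] mem_carrier[OF xN] by simp
  also have "\<dots> = t i j (- x)"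
    using assms by (intro group.inv_equality[OF group_GL]) (simp_all add: transv_in_GL transv_add transv_zero)
  finally show "- x \<in> {c. t i j c \<in> N}"
    using subgroup.m_inv_closed[OF subgroup_axioms xN] by simp
  fix y assume y: "y \<in> {c. t i j c \<in> N}"
  show "x + y \<in> {c. t i j c \<in> N}"
    using x y N_mult[of "t i j x" "t i j y"] assms by (simp add: transv_add)
qed

lemma add_subgroup_level: "add_subgroup level"
  unfolding add_subgroup_def level_def
  using add_subgroup_transv[unfolded add_subgroup_def] by simp

lemma add_subgroup_long_level: "add_subgroup long_level"
proof -
  have "add_subgroup {g. long_transv n i g \<in> N}" if "i \<in> Omega n" for i
    using add_subgroup_transv[of i "- i"] that Omega_nonzero[OF that]
    by (auto simp: add_subgroup_def long_transv_def distrib_left)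
  then show ?thesis
    using add_subgroup_Lambda by (auto simp: long_level_def add_subgroup_def)
qed

text \<open>
  The commutator formulas as criteria for two transvections to commute modulo \<open>N\<close>.
\<close>

lemma commute_short_iff:
  assumes "i \<in> Omega n" "j \<in> Omega n" "k \<in> Omega n"
    "i \<noteq> j" "i \<noteq> - j" "j \<noteq> k" "j \<noteq> - k" "i \<noteq> k" "i \<noteq> - k"
  shows "t i j a \<simeq> t j k b \<longleftrightarrow> t i k (a * b) \<in> N"
  using assms by (intro commute_mod_iff_factor) (simp_all add: transv_in_EU transv_comm_short)

lemma commute_long_iff:
  assumes "i \<in> Omega n" "j \<in> Omega n" "i \<noteq> j" "i \<noteq> - j" and w: "lamsgn i * (a * b) = w"
  shows "t i j a \<simeq> t j (- i) b \<longleftrightarrow> long_transv n i (w - lam * bar w) \<in> N"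
proof (rule commute_mod_iff_factor)
  have "a * b - twist i (- i) (a * b) = bar (lamsgn i) * (w - lam * bar w)"
    using twist_long[OF Omega_nonzero[OF assms(1)], of w]
    by (simp add: w[symmetric] right_diff_distrib)
  then show "t i j a \<otimes>\<^bsub>G\<^esub> t j (- i) b = long_transv n i (w - lam * bar w) \<otimes>\<^bsub>G\<^esub> (t j (- i) b \<otimes>\<^bsub>G\<^esub> t i j a)"
    using assms(1-4) by (simp add: transv_comm_long long_transv_def)
qed (use assms in \<open>auto intro!: transv_in_EU long_transv_in_EU Lambda_min_in\<close>)

lemma commute_short_long_iff:
  assumes "i \<in> Omega n" "k \<in> Omega n" "i \<noteq> k" "i \<noteq> - k" "g \<in> \<Lambda>"
    and "t i (- k) (a * (bar (lamsgn k) * g)) \<in> N"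
  shows "t i k a \<simeq> long_transv n k g \<longleftrightarrow> long_transv n i (a * g * bar a) \<in> N"
proof -
  let ?z = "matr_mult n (t i (- k) (a * (bar (lamsgn k) * g))) (long_transv n i (a * g * bar a))"
  have E: "long_transv n i (a * g * bar a) \<in> EU_abs bar lam \<Lambda> n"
    using assms Lambda_conj by (simp add: long_transv_in_EU)
  have "t i k a \<simeq> long_transv n k g \<longleftrightarrow> ?z \<in> N"
  proof (rule commute_mod_iff_factor)
    show "?z \<in> carrier G"
      using subgroup.m_closed[OF subgroup_EU_abs transv_in_EU E, of i "- k"] assms(1-4) by simp
    show "t i k a \<otimes>\<^bsub>G\<^esub> long_transv n k g = ?z \<otimes>\<^bsub>G\<^esub> (long_transv n k g \<otimes>\<^bsub>G\<^esub> t i k a)"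
      using transv_comm_short_long[OF assms(1-4) twist_long_Lambda[OF _ assms(5)], of a] Omega_nonzero[OF assms(2)]
      by (simp add: long_transv_def conj_twist)
  qed (use assms in \<open>auto intro!: transv_in_EU long_transv_in_EU\<close>)
  then show ?thesis using N_left_cancel[OF assms(6) E] by simp
qed

lemma level_mult:
  assumes "c \<in> level"
  shows "c * r \<in> level" "r * c \<in> level"
proof -
  have "t i j (c * r) \<in> N \<and> t i j (r * c) \<in> N"
    if ij: "i \<in> Omega n" "j \<in> Omega n" "i \<noteq> j" "i \<noteq> - j" for i j
  proof -
    obtain h where h: "h \<in> Omega n" "h \<noteq> i" "h \<noteq> - i" "h \<noteq> j" "h \<noteq> - j"
      using third_index[OF n_ge_3] .
    then have h': "i \<noteq> h" "i \<noteq> - h" by auto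
    have "t i h c \<simeq> t h j r" "t h j c \<simeq> t i h r"
      using assms ij h h' by (auto intro!: commute_mod_member levelD transv_in_EU)
    then show ?thesis
      using commute_short_iff[OF ij(1) h(1) ij(2) h' h(4,5) ij(3,4)] by (simp add: commute_mod_sym)
  qed
  then show "c * r \<in> level" "r * c \<in> level" by (simp_all add: level_def)
qed

lemma level_trace:
  assumes "w \<in> level"
  shows "w - lam * bar w \<in> long_level"
proof -
  have "long_transv n i (w - lam * bar w) \<in> N" if i: "i \<in> Omega n" for i
  proof -
    obtain j where j: "j \<in> Omega n" "j \<noteq> i" "j \<noteq> - i"
      using third_index[OF n_ge_3] .
    then have "t i j (bar (lamsgn i) * w) \<simeq> t j (- i) 1"
      using i level_mult[OF assms] by (auto intro!: commute_mod_member levelD transv_in_EU)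
    then show ?thesis using i j commute_long_iff[of i j "bar (lamsgn i) * w" 1 w] by fastforce
  qed
  then show ?thesis by (simp add: long_level_def Lambda_min_in)
qed

lemma level_conj:
  assumes "a \<in> level" "g \<in> \<Lambda>"
  shows "a * g * bar a \<in> long_level"
proof -
  have "long_transv n i (a * g * bar a) \<in> N" if i: "i \<in> Omega n" for i
  proof -
    obtain k where k: "k \<in> Omega n" "k \<noteq> i" "k \<noteq> - i"
      using third_index[OF n_ge_3] .
    then have k': "i \<noteq> k" "i \<noteq> - k" "i \<noteq> - (- k)" by auto
    have "t i k a \<simeq> long_transv n k g" "t i (- k) (a * (bar (lamsgn k) * g)) \<in> N"
      using i k k' assms level_mult[OF assms(1)]
      by (auto intro!: commute_mod_member levelD long_transv_in_EU)
    then show ?thesis using i k k' assms commute_short_long_iff by blast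
  qed
  then show ?thesis using assms by (simp add: long_level_def Lambda_conj)
qed

end

section \<open>Form ideals and comaximality\<close>

lemma group_closure_subset:
  assumes "add_subgroup H" "S \<subseteq> H"
  shows "group_closure S \<subseteq> H"
proof
  fix x assume "x \<in> group_closure S"
  then show "x \<in> H"
  proof induction
    case (base s)
    then show ?case using assms by (auto simp: add_subgroup_def)
  next
    case (diff s t)
    then show ?case using assms(1) unfolding add_subgroup_def by (metis diff_conv_add_uminus)
  qed
qed

lemma add_subgroup_plus_subset:
  "add_subgroup H \<Longrightarrow> A \<subseteq> H \<Longrightarrow> B \<subseteq> H \<Longrightarrow> A + B \<subseteq> H"
  unfolding add_subgroup_def by (blast elim: set_plus_elim)

lemma subset_plus_left: "0 \<in> B \<Longrightarrow> A \<subseteq> A + B" for A B :: "'a::comm_monoid_add set"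
  using set_zero_plus2[of B A] by (simp add: add.commute[of A B])

lemma mem_ideal_mult: "a \<in> I \<Longrightarrow> b \<in> J \<Longrightarrow> a * b \<in> ideal_mult I J"
  unfolding ideal_mult_def by (rule group_closure.base) (simp add: set_times_intro)

lemma mem_form_act: "b \<in> J \<Longrightarrow> g \<in> \<Gamma> \<Longrightarrow> b * g * bar b \<in> form_act bar J \<Gamma>"
  unfolding form_act_def by (rule group_closure.base) blast

context form_ring
begin

lemma form_idealD:
  assumes "form_ideal bar lam \<Lambda> (I, \<Gamma>)"
  shows "0 \<in> I" "x \<in> I \<Longrightarrow> y \<in> I \<Longrightarrow> x + y \<in> I" "x \<in> I \<Longrightarrow> - x \<in> I"
    "x \<in> I \<Longrightarrow> c * x \<in> I" "x \<in> I \<Longrightarrow> x * c \<in> I" "x \<in> I \<Longrightarrow> bar x \<in> I"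
    "add_subgroup \<Gamma>" "g \<in> \<Gamma> \<Longrightarrow> g \<in> I" "\<Gamma> \<subseteq> \<Lambda>" "g \<in> \<Gamma> \<Longrightarrow> c * g * bar c \<in> \<Gamma>"
  using assms by (auto simp: form_ideal_def two_sided_ideal_def add_subgroup_def Gamma_max_def)

lemma form_ideal_twist: "form_ideal bar lam \<Lambda> (I, \<Gamma>) \<Longrightarrow> a \<in> I \<Longrightarrow> twist i j a \<in> I"
  unfolding twist_def using form_idealD(4)[OF _ form_idealD(6)] by blast

lemma form_ideal_Gamma_min:
  assumes "form_ideal bar lam \<Lambda> (I, \<Gamma>)"
  shows "x \<in> I \<Longrightarrow> x - lam * bar x \<in> \<Gamma>" "x \<in> I \<Longrightarrow> g \<in> \<Lambda> \<Longrightarrow> x * g * bar x \<in> \<Gamma>"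
proof -
  have G: "Gamma_min bar lam \<Lambda> I \<subseteq> \<Gamma>" using assms by (simp add: form_ideal_def)
  have "{a - lam * bar a | a. a \<in> I} \<subseteq> Gamma_min bar lam \<Lambda> I"
    unfolding Gamma_min_def by (rule subset_plus_left) (simp add: form_act_def)
  then show "x - lam * bar x \<in> \<Gamma>" if "x \<in> I"
    using that G by blast
  have "0 - lam * bar 0 \<in> {a - lam * bar a | a. a \<in> I}"
    using form_idealD(1)[OF assms] by blast
  then have "form_act bar I \<Lambda> \<subseteq> Gamma_min bar lam \<Lambda> I"
    unfolding Gamma_min_def by (intro set_zero_plus2) simp
  then show "x * g * bar x \<in> \<Gamma>" if "x \<in> I" "g \<in> \<Lambda>"
    using that G mem_form_act by blast
qed

text \<open>
  Expand \<open>(p + q) g bar (p + q)\<close>. The mixed terms \<open>p g bar q\<close> and \<open>q g bar p\<close> combine to an element of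
  the form \<open>x - lam bar x\<close> because \<open>g\<close> satisfies \<open>lam bar g = - g\<close>. If \<open>p \<in> I\<close> and \<open>q \<in> J\<close>, this \<open>x\<close> lies
  in both ideals.
\<close>

lemma conj_partition:
  assumes "p + q = 1" "g \<in> \<Lambda>"
  shows "g = p * g * bar p + q * g * bar q + (p * g * bar q - lam * bar (p * g * bar q))"
proof -
  have "bar p + bar q = 1" using assms(1) by (metis bar_add bar_one)
  then have "g = (p + q) * g * (bar p + bar q)" using assms(1) by simp
  also have "\<dots> = p * g * bar p + q * g * bar q + (p * g * bar q + q * g * bar p)"
    by (simp add: algebra_simps)
  also have "q * g * bar p = - (lam * bar (p * g * bar q))"
  proof -
    have "lam * bar (p * g * bar q) = (lam * q) * (bar g * bar p)"
      by (simp add: bar_mult bar_bar mult.assoc)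
    also have "\<dots> = q * (lam * bar g) * bar p"
      by (simp add: lam_central[of q] mult.assoc)
    finally show ?thesis by (simp add: Lambda_eq[OF assms(2)])
  qed
  finally show ?thesis by simp
qed

text \<open>
  For short transvections this is \<open>I + J = UNIV\<close>. For long ones it is \<open>\<Lambda> = \<Gamma> + \<Delta>\<close>, which follows
  from \<open>conj_partition\<close> since \<open>Gamma_min\<close> of each ideal is contained in its form parameter.
\<close>

lemma generate_comaximal:
  assumes F: "form_ideal bar lam \<Lambda> (I, \<Gamma>)" "form_ideal bar lam \<Lambda> (J, \<Delta>)" and IJ: "I + J = UNIV"
  shows "generate (GL n) (elem_gens bar lam n (I, \<Gamma>) \<union> elem_gens bar lam n (J, \<Delta>)) = EU_abs bar lam \<Lambda> n"
    (is "generate _ (?X \<union> ?Y) = _")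
proof
  note GL_gen = group.generate_subgroup_incl[OF group_GL]
  have XY: "?X \<union> ?Y \<subseteq> EU_abs bar lam \<Lambda> n"
    using elem_gens_subset_EU_abs form_idealD(9) F by simp
  then show "generate (GL n) (?X \<union> ?Y) \<subseteq> EU_abs bar lam \<Lambda> n"
    by (rule GL_gen[OF _ subgroup_EU_abs])
  have sub: "subgroup (generate (GL n) (?X \<union> ?Y)) (GL n)"
    using elem_gens_in_GL by (intro group.generate_is_subgroup[OF group_GL]) blast
  have mult: "matr_mult n x y \<in> generate (GL n) (?X \<union> ?Y)"
    if "x \<in> generate (GL n) (?X \<union> ?Y)" "y \<in> generate (GL n) (?X \<union> ?Y)" for x y
    using generate.eng[OF that] by simp
  have short: "T n i j c \<in> generate (GL n) (?X \<union> ?Y)"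
    if ij: "i \<in> Omega n" "j \<in> Omega n" "i \<noteq> j" "i \<noteq> - j" for i j c
  proof -
    obtain a b where ab: "a \<in> I" "b \<in> J" "c = a + b"
      using IJ by (metis UNIV_I set_plus_elim)
    have "T n i j a \<in> ?X \<union> ?Y" "T n i j b \<in> ?X \<union> ?Y"
      unfolding elem_gens_eq using ij ab by blast+
    then show ?thesis
      using mult[OF generate.incl generate.incl] transv_add[OF ij(1-3)] ab(3) by metis
  qed
  have long: "long_transv n i g \<in> generate (GL n) (?X \<union> ?Y)"
    if i: "i \<in> Omega n" and g: "g \<in> \<Lambda>" for i g
  proof -
    obtain p q where pq: "p \<in> I" "q \<in> J" "p + q = 1"
      using IJ by (metis UNIV_I set_plus_elim)
    let ?x = "p * g * bar q"
    have "p * g * bar p + (?x - lam * bar ?x) \<in> \<Gamma>"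
      using form_ideal_Gamma_min[OF F(1)] form_idealD(5,7)[OF F(1)] pq(1) g by (auto simp: add_subgroup_def)
    moreover have "q * g * bar q \<in> \<Delta>"
      using form_ideal_Gamma_min[OF F(2)] pq(2) g by blast
    ultimately have "long_transv n i (p * g * bar p + (?x - lam * bar ?x)) \<in> ?X \<union> ?Y"
      "long_transv n i (q * g * bar q) \<in> ?X \<union> ?Y"
      unfolding elem_gens_eq using i by blast+
    then have "long_transv n i (p * g * bar p + (?x - lam * bar ?x) + q * g * bar q)
        \<in> generate (GL n) (?X \<union> ?Y)"
      using mult[OF generate.incl generate.incl] long_transv_add[OF i] by metis
    also have "p * g * bar p + (?x - lam * bar ?x) + q * g * bar q = g"
      using conj_partition[OF pq(3) g] by (simp add: algebra_simps)
    finally show ?thesis .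
  qed
  show "EU_abs bar lam \<Lambda> n \<subseteq> generate (GL n) (?X \<union> ?Y)"
    unfolding EU_abs_def
    by (rule GL_gen[OF _ sub]) (auto simp: elem_gens_eq[of n UNIV] short long)
qed

end

context EU_normal
begin

text \<open>
  The condition on \<open>N\<close> that links the symmetrised product to commutators. It lists the products of
  parameters which occur in the commutator formulas; it is equivalent both to \<open>N\<close> containing the
  generators of the symmetrised product (\<open>symm_prod_gens_subset_iff\<close>) and to the two families of
  generators commuting modulo \<open>N\<close> (\<open>gens_commute_absorbs\<close>, \<open>absorbs_gens_commute\<close>). Being
  symmetric in the two form ideals, it halves the number of cases.
\<close>

definition absorbs_products :: "'a set \<Rightarrow> 'a set \<Rightarrow> 'a set \<Rightarrow> 'a set \<Rightarrow> bool" where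
  "absorbs_products I \<Gamma> J \<Delta> \<longleftrightarrow>
    (\<forall>a\<in>I. \<forall>b\<in>J. a * b \<in> level \<and> b * a \<in> level) \<and>
    (\<forall>b\<in>J. \<forall>g\<in>\<Gamma>. b * g * bar b \<in> long_level) \<and>
    (\<forall>a\<in>I. \<forall>d\<in>\<Delta>. a * d * bar a \<in> long_level)"

lemma absorbs_products_sym: "absorbs_products I \<Gamma> J \<Delta> \<Longrightarrow> absorbs_products J \<Delta> I \<Gamma>"
  by (auto simp: absorbs_products_def)

text \<open>
  Once the ideal \<open>IJ + JI\<close> lies in \<open>level\<close>, the summand \<open>Gamma_min\<close> of the symmetrised product is
  taken care of by \<open>level_trace\<close> and \<open>level_conj\<close>.
\<close>

lemma symm_prod_gens_subset_iff:
  assumes F: "form_ideal bar lam \<Lambda> (I, \<Gamma>)" "form_ideal bar lam \<Lambda> (J, \<Delta>)"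
  shows "elem_gens bar lam n (symm_prod bar lam \<Lambda> (I, \<Gamma>) (J, \<Delta>)) \<subseteq> N \<longleftrightarrow> absorbs_products I \<Gamma> J \<Delta>"
    and "snd (symm_prod bar lam \<Lambda> (I, \<Gamma>) (J, \<Delta>)) \<subseteq> \<Lambda>"
proof -
  let ?K = "ideal_mult I J + ideal_mult J I"
  let ?A = "form_act bar J \<Gamma>" and ?B = "form_act bar I \<Delta>"
  let ?P = "Gamma_min bar lam \<Lambda> ?K + ?A + ?B"
  have actL: "form_act bar S H \<subseteq> \<Lambda>" if "H \<subseteq> \<Lambda>" for S H
    unfolding form_act_def
    using that Lambda_conj by (intro group_closure_subset[OF add_subgroup_Lambda]) auto
  have minL: "Gamma_min bar lam \<Lambda> S \<subseteq> \<Lambda>" for S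
    unfolding Gamma_min_def
    using Lambda_min_in by (intro add_subgroup_plus_subset[OF add_subgroup_Lambda] actL) auto
  have PL: "?P \<subseteq> \<Lambda>"
    using F by (intro add_subgroup_plus_subset[OF add_subgroup_Lambda] actL minL) (simp_all add: form_idealD)
  then show "snd (symm_prod bar lam \<Lambda> (I, \<Gamma>) (J, \<Delta>)) \<subseteq> \<Lambda>"
    by (simp add: symm_prod_def)
  have z: "0 \<in> ideal_mult I J" "0 \<in> ideal_mult J I" "0 \<in> ?A" "0 \<in> ?B" "0 \<in> form_act bar ?K \<Lambda>"
    by (simp_all add: ideal_mult_def form_act_def)
  have IJ: "ideal_mult I J \<subseteq> ?K" "ideal_mult J I \<subseteq> ?K"
    using z by (simp_all add: subset_plus_left set_zero_plus2)
  then have "0 \<in> ?K" using z by blast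
  then have "0 - lam * bar 0 \<in> {a - lam * bar a | a. a \<in> ?K}" by blast
  then have zm: "0 \<in> Gamma_min bar lam \<Lambda> ?K"
    unfolding Gamma_min_def using subsetD[OF subset_plus_left[OF z(5)]] by simp
  have K: "?K \<subseteq> level \<longleftrightarrow> (\<forall>a\<in>I. \<forall>b\<in>J. a * b \<in> level \<and> b * a \<in> level)"
  proof
    assume K: "?K \<subseteq> level"
    have "a * b \<in> ?K" "b * a \<in> ?K" if "a \<in> I" "b \<in> J" for a b
      using IJ mem_ideal_mult that by blast+
    then show "\<forall>a\<in>I. \<forall>b\<in>J. a * b \<in> level \<and> b * a \<in> level" using K by blast
  next
    assume "\<forall>a\<in>I. \<forall>b\<in>J. a * b \<in> level \<and> b * a \<in> level"
    then show "?K \<subseteq> level"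
      unfolding ideal_mult_def
      by (intro add_subgroup_plus_subset group_closure_subset add_subgroup_level)
        (auto elim!: set_times_elim)
  qed
  have P: "?P \<subseteq> long_level \<longleftrightarrow> (\<forall>b\<in>J. \<forall>g\<in>\<Gamma>. b * g * bar b \<in> long_level) \<and>
      (\<forall>a\<in>I. \<forall>d\<in>\<Delta>. a * d * bar a \<in> long_level)" if K: "?K \<subseteq> level"
  proof
    assume P: "?P \<subseteq> long_level"
    have "?A \<subseteq> ?P"
      using subset_plus_left[OF z(4)] set_zero_plus2[OF zm] by blast
    moreover have "?B \<subseteq> ?P"
      using zm z(3) subset_plus_left by (intro set_zero_plus2) blast
    ultimately show "(\<forall>b\<in>J. \<forall>g\<in>\<Gamma>. b * g * bar b \<in> long_level) \<and>
      (\<forall>a\<in>I. \<forall>d\<in>\<Delta>. a * d * bar a \<in> long_level)"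
      using P mem_form_act[of _ _ _ _ bar] by blast
  next
    assume "(\<forall>b\<in>J. \<forall>g\<in>\<Gamma>. b * g * bar b \<in> long_level) \<and>
      (\<forall>a\<in>I. \<forall>d\<in>\<Delta>. a * d * bar a \<in> long_level)"
    then show "?P \<subseteq> long_level"
      unfolding Gamma_min_def form_act_def
      using K level_trace level_conj
      by (intro add_subgroup_plus_subset group_closure_subset add_subgroup_long_level) auto
  qed
  have "elem_gens bar lam n (symm_prod bar lam \<Lambda> (I, \<Gamma>) (J, \<Delta>)) \<subseteq> N \<longleftrightarrow> ?K \<subseteq> level \<and> ?P \<subseteq> long_level"
    using elem_gens_subset_iff[OF PL] by (simp add: symm_prod_def)
  then show "elem_gens bar lam n (symm_prod bar lam \<Lambda> (I, \<Gamma>) (J, \<Delta>)) \<subseteq> N \<longleftrightarrow> absorbs_products I \<Gamma> J \<Delta>"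
    unfolding absorbs_products_def using K P by blast
qed

section \<open>Generators commuting modulo a normal subgroup\<close>

definition gens_commute :: "'a set \<Rightarrow> 'a set \<Rightarrow> 'a set \<Rightarrow> 'a set \<Rightarrow> bool" where
  "gens_commute I \<Gamma> J \<Delta> \<longleftrightarrow>
    (\<forall>x\<in>elem_gens bar lam n (I, \<Gamma>). \<forall>y\<in>elem_gens bar lam n (J, \<Delta>). x \<simeq> y)"

lemma gens_commute_sym: "gens_commute I \<Gamma> J \<Delta> \<Longrightarrow> gens_commute J \<Delta> I \<Gamma>"
  using commute_mod_sym[of G N] unfolding gens_commute_def by auto

lemma short_in_gens:
  "i \<in> Omega n \<Longrightarrow> j \<in> Omega n \<Longrightarrow> i \<noteq> j \<Longrightarrow> i \<noteq> - j \<Longrightarrow> c \<in> I \<Longrightarrow> t i j c \<in> elem_gens bar lam n (I, \<Gamma>)"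
  unfolding elem_gens_eq by blast

lemma long_in_gens: "i \<in> Omega n \<Longrightarrow> g \<in> \<Gamma> \<Longrightarrow> long_transv n i g \<in> elem_gens bar lam n (I, \<Gamma>)"
  unfolding elem_gens_eq by blast

lemma gens_commute_level:
  assumes "gens_commute I \<Gamma> J \<Delta>" "a \<in> I" "b \<in> J"
  shows "a * b \<in> level"
proof -
  have "t i j (a * b) \<in> N" if ij: "i \<in> Omega n" "j \<in> Omega n" "i \<noteq> j" "i \<noteq> - j" for i j
  proof -
    obtain h where h: "h \<in> Omega n" "h \<noteq> i" "h \<noteq> - i" "h \<noteq> j" "h \<noteq> - j"
      using third_index[OF n_ge_3] .
    then have h': "i \<noteq> h" "i \<noteq> - h" by auto
    have "t i h a \<in> elem_gens bar lam n (I, \<Gamma>)" "t h j b \<in> elem_gens bar lam n (J, \<Delta>)"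
      using assms ij h h' by (simp_all add: short_in_gens)
    then have "t i h a \<simeq> t h j b"
      using assms(1) unfolding gens_commute_def by blast
    then show ?thesis
      using commute_short_iff[OF ij(1) h(1) ij(2) h' h(4,5) ij(3,4)] by simp
  qed
  then show ?thesis by (simp add: level_def)
qed

lemma gens_commute_long_level:
  assumes gc: "gens_commute I \<Gamma> J \<Delta>" and F: "form_ideal bar lam \<Lambda> (I, \<Gamma>)" and bg: "b \<in> J" "g \<in> \<Gamma>"
  shows "b * g * bar b \<in> long_level"
proof -
  have g: "g \<in> \<Lambda>" "g \<in> I" using form_idealD(8,9)[OF F] bg by auto
  have "long_transv n i (b * g * bar b) \<in> N" if i: "i \<in> Omega n" for i
  proof -
    obtain k where k: "k \<in> Omega n" "k \<noteq> i" "k \<noteq> - i"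
      using third_index[OF n_ge_3] .
    then have k': "i \<noteq> k" "i \<noteq> - k" "i \<noteq> - (- k)" by auto
    have "t i k b \<in> elem_gens bar lam n (J, \<Delta>)" "long_transv n k g \<in> elem_gens bar lam n (I, \<Gamma>)"
      using i k k' bg by (simp_all add: short_in_gens long_in_gens)
    then have "t i k b \<simeq> long_transv n k g"
      using gens_commute_sym[OF gc] unfolding gens_commute_def by blast
    moreover have "b * (bar (lamsgn k) * g) \<in> level"
      using gens_commute_level[OF gens_commute_sym[OF gc]] bg form_idealD(4)[OF F g(2)] by blast
    then have "t i (- k) (b * (bar (lamsgn k) * g)) \<in> N"
      using i k k' by (intro levelD) auto
    ultimately show ?thesis using commute_short_long_iff[OF i k(1) k'(1,2) g(1)] by blast
  qed
  then show ?thesis using g by (simp add: long_level_def Lambda_conj)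
qed

lemma gens_commute_absorbs:
  assumes "form_ideal bar lam \<Lambda> (I, \<Gamma>)" "form_ideal bar lam \<Lambda> (J, \<Delta>)" "gens_commute I \<Gamma> J \<Delta>"
  shows "absorbs_products I \<Gamma> J \<Delta>"
  unfolding absorbs_products_def
  using gens_commute_level[OF assms(3)] gens_commute_level[OF gens_commute_sym[OF assms(3)]]
    gens_commute_long_level[OF assms(3,1)] gens_commute_long_level[OF gens_commute_sym[OF assms(3)] assms(2)]
  by simp

text \<open>
  Adjacent, non-opposite roots. Their sum is long when \<open>i = - l\<close> and short otherwise.
\<close>

lemma commute_short_adjacent:
  assumes abs: "absorbs_products I \<Gamma> J \<Delta>" and ab: "a \<in> I" "b \<in> J"
    and ijl: "i \<in> Omega n" "j \<in> Omega n" "l \<in> Omega n" "i \<noteq> j" "i \<noteq> - j" "j \<noteq> l" "j \<noteq> - l" "i \<noteq> l"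
  shows "t i j a \<simeq> t j l b"
proof (cases "i = - l")
  case True
  have "a * b \<in> level" using abs ab by (simp add: absorbs_products_def)
  then have "long_transv n i (lamsgn i * (a * b) - lam * bar (lamsgn i * (a * b))) \<in> N"
    using level_trace[OF level_mult(2)] ijl(1) by (simp add: long_level_def)
  then show ?thesis
    using commute_long_iff[OF ijl(1,2,4,5) refl, of a b] True by simp
next
  case False
  then show ?thesis
    using commute_short_iff[of i j l a b] ijl abs ab levelD by (simp add: absorbs_products_def)
qed

text \<open>
  Two non-opposite roots either satisfy the hypotheses of \<open>transv_commute\<close> or become adjacent after
  replacing \<open>(i, j)\<close> or \<open>(k, l)\<close> by \<open>(-j, -i)\<close> or \<open>(-l, -k)\<close>, or after exchanging the two ideals.
\<close>

lemma commute_short_nonopposite: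
  assumes abs: "absorbs_products I \<Gamma> J \<Delta>" and ab: "a \<in> I" "b \<in> J"
    and F: "form_ideal bar lam \<Lambda> (I, \<Gamma>)" "form_ideal bar lam \<Lambda> (J, \<Delta>)"
    and ij: "i \<in> Omega n" "j \<in> Omega n" "i \<noteq> j" "i \<noteq> - j"
    and kl: "k \<in> Omega n" "l \<in> Omega n" "k \<noteq> l" "k \<noteq> - l"
    and opp: "\<not> (k = j \<and> l = i)" "\<not> (k = - i \<and> l = - j)"
  shows "t i j a \<simeq> t k l b"
proof -
  have a': "- twist i j a \<in> I" and b': "- twist k l b \<in> J"
    using ab F form_ideal_twist form_idealD(3) by blast+
  have flip_a: "t i j a = t (- j) (- i) (- twist i j a)" and flip_b: "t k l b = t (- l) (- k) (- twist k l b)"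
    using ij kl by (auto intro!: transv_flip)
  consider "j = k" | "j = - l" | "i = - k" | "i = l" | "j \<noteq> k" "j \<noteq> - l" "i \<noteq> - k" "i \<noteq> l" by blast
  then show ?thesis
  proof cases
    case 1
    then show ?thesis using commute_short_adjacent[OF abs ab] ij kl opp by auto
  next
    case 2
    then show ?thesis unfolding flip_b
      using commute_short_adjacent[OF abs ab(1) b', of i j "- k"] ij kl opp by auto
  next
    case 3
    then show ?thesis unfolding flip_a
      using commute_short_adjacent[OF abs a' ab(2), of "- j" "- i" l] ij kl opp by auto
  next
    case 4
    then show ?thesis
      using commute_short_adjacent[OF absorbs_products_sym[OF abs] ab(2,1), of k l j] ij kl opp
      by (subst commute_mod_sym) auto
  next
    case 5
    then show ?thesis using transv_commute[OF ij(1,2) kl(1,2)] by (simp add: commute_mod_def)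
  qed
qed

lemma commute_short_long:
  assumes abs: "absorbs_products I \<Gamma> J \<Delta>" and ab: "a \<in> I" "d \<in> \<Delta>"
    and F: "form_ideal bar lam \<Lambda> (I, \<Gamma>)" "form_ideal bar lam \<Lambda> (J, \<Delta>)"
    and ij: "i \<in> Omega n" "j \<in> Omega n" "i \<noteq> j" "i \<noteq> - j" and k: "k \<in> Omega n"
  shows "t i j a \<simeq> long_transv n k d"
proof -
  have d: "d \<in> \<Lambda>" "d \<in> J" using form_idealD(8,9)[OF F(2)] ab by auto
  have adj: "t i k a \<simeq> long_transv n k d" if i: "i \<in> Omega n" "i \<noteq> k" "i \<noteq> - k" and a: "a \<in> I" for i a
  proof -
    have "a * (bar (lamsgn k) * d) \<in> level"
      using abs a form_idealD(4)[OF F(2) d(2)] by (simp add: absorbs_products_def)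
    then have "t i (- k) (a * (bar (lamsgn k) * d)) \<in> N"
      using i k by (intro levelD) auto
    moreover have "long_transv n i (a * d * bar a) \<in> N"
      using abs a ab(2) i by (simp add: absorbs_products_def long_level_def)
    ultimately show ?thesis using i k d commute_short_long_iff by blast
  qed
  consider "j = k" | "i = - k" | "j \<noteq> k" "i \<noteq> - k" by blast
  then show ?thesis
  proof cases
    case 1
    then show ?thesis using adj ij ab by blast
  next
    case 2
    have "t i j a = t (- j) k (- twist i j a)" using transv_flip[of i n j a] ij 2 by auto
    moreover have "- twist i j a \<in> I"
      using ab F form_ideal_twist form_idealD(3) by blast
    ultimately show ?thesis using adj[of "- j"] ij 2 by auto
  next
    case 3
    then show ?thesis
      using transv_commute[of i n j k "- k"] ij k by (simp add: commute_mod_def long_transv_def)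
  qed
qed

abbreviation cent :: "'a matr \<Rightarrow> 'a matr set" where
  "cent x \<equiv> centralizer_mod G N {x}"

lemma subgroup_centr: "x \<in> EU_abs bar lam \<Lambda> n \<Longrightarrow> subgroup (cent x) G"
  by (rule subgroup_centralizer_mod) simp

lemma mem_centr: "g \<in> cent x \<longleftrightarrow> g \<in> EU_abs bar lam \<Lambda> n \<and> g \<simeq> x"
  by (simp add: centralizer_mod_def)

lemma N_subset_centr: "x \<in> EU_abs bar lam \<Lambda> n \<Longrightarrow> g \<in> N \<Longrightarrow> g \<in> cent x"
  using subset_centralizer_mod[of "{x}"] by auto

text \<open>
  No commutator formula exists for opposite roots, and here comaximality is needed. Split
  \<open>a = a p + a q\<close>. The second summand lies in \<open>level\<close>. The first one gives a commutator of
  transvections at \<open>(i, h)\<close> and \<open>(h, j)\<close> with entries \<open>a\<close> and \<open>p\<close> in \<open>I\<close>; neither root is opposite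
  to \<open>(j, i)\<close>, so both factors commute with \<open>t j i b\<close> modulo \<open>N\<close>, and so does the commutator.
\<close>

lemma commute_short_opposite:
  assumes abs: "absorbs_products I \<Gamma> J \<Delta>" and ab: "a \<in> I" "b \<in> J"
    and F: "form_ideal bar lam \<Lambda> (I, \<Gamma>)" "form_ideal bar lam \<Lambda> (J, \<Delta>)"
    and pq: "p \<in> I" "q \<in> J" "p + q = 1"
    and ij: "i \<in> Omega n" "j \<in> Omega n" "i \<noteq> j" "i \<noteq> - j"
  shows "t i j a \<simeq> t j i b"
proof -
  let ?x = "t j i b"
  have ji: "j \<noteq> i" "j \<noteq> - i" using ij by auto
  have x: "?x \<in> EU_abs bar lam \<Lambda> n" using ij ji by (intro transv_in_EU)
  interpret C: subgroup "cent ?x" G by (rule subgroup_centr[OF x])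
  obtain h where h: "h \<in> Omega n" "h \<noteq> i" "h \<noteq> - i" "h \<noteq> j" "h \<noteq> - j"
    using third_index[OF n_ge_3] .
  then have h': "i \<noteq> h" "i \<noteq> - h" by auto
  have "t i h a \<simeq> ?x"
    by (rule commute_short_nonopposite[OF abs ab F ij(1) h(1) h' ij(2,1) ji]) (use h in auto)
  then have ih: "t i h a \<in> cent ?x"
    using transv_in_EU[OF ij(1) h(1) h'] by (simp add: mem_centr)
  have "t h j p \<simeq> ?x"
    by (rule commute_short_nonopposite[OF abs pq(1) ab(2) F h(1) ij(2) h(4,5) ij(2,1) ji]) (use h h' ij in auto)
  then have hj: "t h j p \<in> cent ?x"
    using transv_in_EU[OF h(1) ij(2) h(4,5)] by (simp add: mem_centr)
  have "t i h a \<otimes>\<^bsub>G\<^esub> t h j p = t i j (a * p) \<otimes>\<^bsub>G\<^esub> (t h j p \<otimes>\<^bsub>G\<^esub> t i h a)"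
    using transv_comm_short[OF ij(1) h(1) ij(2) h' h(4,5) ij(3,4)] by simp
  then have "t i j (a * p) \<otimes>\<^bsub>G\<^esub> (t h j p \<otimes>\<^bsub>G\<^esub> t i h a) \<in> cent ?x"
    using C.m_closed[OF ih hj] by simp
  then have "t i j (a * p) \<in> cent ?x"
    using subgroup_cancel_right[OF C.subgroup_axioms _ C.m_closed[OF hj ih]] transv_in_EU[OF ij] by simp
  moreover have "t i j (a * q) \<in> cent ?x"
    using abs ab pq ij by (intro N_subset_centr[OF x] levelD) (simp_all add: absorbs_products_def)
  ultimately have "t i j (a * p) \<otimes>\<^bsub>G\<^esub> t i j (a * q) \<in> cent ?x"
    by (rule C.m_closed)
  moreover have "a * p + a * q = a" using pq by (simp add: distrib_left[symmetric])
  ultimately show ?thesis using ij by (simp add: transv_add mem_centr)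
qed

lemma commute_short_short:
  assumes abs: "absorbs_products I \<Gamma> J \<Delta>" and ab: "a \<in> I" "b \<in> J"
    and F: "form_ideal bar lam \<Lambda> (I, \<Gamma>)" "form_ideal bar lam \<Lambda> (J, \<Delta>)"
    and pq: "p \<in> I" "q \<in> J" "p + q = 1"
    and ij: "i \<in> Omega n" "j \<in> Omega n" "i \<noteq> j" "i \<noteq> - j"
    and kl: "k \<in> Omega n" "l \<in> Omega n" "k \<noteq> l" "k \<noteq> - l"
  shows "t i j a \<simeq> t k l b"
proof -
  consider "k = j \<and> l = i" | "k = - i \<and> l = - j" | "\<not> (k = j \<and> l = i)" "\<not> (k = - i \<and> l = - j)"
    by blast
  then show ?thesis
  proof cases
    case 1
    then show ?thesis using commute_short_opposite[OF abs ab F pq ij] by simp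
  next
    case 2
    have "l \<noteq> - k" using kl(4) by auto
    then have "t k l b = t j i (- twist k l b)"
      using transv_flip[OF kl(1,2)] 2 by simp
    moreover have "- twist k l b \<in> J"
      by (intro form_idealD(3)[OF F(2)] form_ideal_twist[OF F(2)] ab)
    ultimately show ?thesis using commute_short_opposite[OF abs ab(1) _ F pq ij] by simp
  next
    case 3
    show ?thesis by (rule commute_short_nonopposite[OF abs ab F ij kl 3])
  qed
qed

lemma commute_long_nonopposite:
  assumes "i \<in> Omega n" "k \<in> Omega n" "k \<noteq> - i"
  shows "long_transv n i g \<simeq> long_transv n k d"
proof -
  have "- i \<noteq> k" "- i \<noteq> - (- k)" "i \<noteq> - k" using assms(3) by auto
  then show ?thesis
    using transv_commute[of i n "- i" k "- k"] assms(1,2) by (simp add: commute_mod_def long_transv_def)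
qed

text \<open>
  The same idea for long roots. By \<open>conj_partition\<close> the parameter \<open>g\<close> is \<open>p g bar p\<close> up to an element
  of \<open>long_level\<close>, and \<open>transv_comm_short_long\<close> expresses the long transvection with parameter
  \<open>p g bar p\<close> by transvections for roots that are not opposite to \<open>(-i, i)\<close>.
\<close>

lemma commute_long_opposite:
  assumes abs: "absorbs_products I \<Gamma> J \<Delta>" and gd: "g \<in> \<Gamma>" "d \<in> \<Delta>"
    and F: "form_ideal bar lam \<Lambda> (I, \<Gamma>)" "form_ideal bar lam \<Lambda> (J, \<Delta>)"
    and pq: "p \<in> I" "q \<in> J" "p + q = 1"
    and i: "i \<in> Omega n"
  shows "long_transv n i g \<simeq> long_transv n (- i) d"
proof -
  let ?x = "long_transv n (- i) d"
  have gd': "g \<in> \<Lambda>" "g \<in> I" "d \<in> \<Lambda>" "d \<in> J"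
    using gd form_idealD(8,9)[OF F(1)] form_idealD(8,9)[OF F(2)] by auto
  have x: "?x \<in> EU_abs bar lam \<Lambda> n" using i gd' by (simp add: long_transv_in_EU)
  interpret C: subgroup "cent ?x" G by (rule subgroup_centr[OF x])
  obtain h where h: "h \<in> Omega n" "h \<noteq> i" "h \<noteq> - i"
    using third_index[OF n_ge_3] .
  then have h': "i \<noteq> h" "i \<noteq> - h" "i \<noteq> - (- h)" "- i \<noteq> - h" by auto
  have i': "- i \<in> Omega n" and mh: "- h \<in> Omega n" using i h by simp_all
  let ?s = "t i h p" and ?l = "long_transv n h g" and ?r = "t i (- h) (p * (bar (lamsgn h) * g))"
  let ?m = "long_transv n i (p * g * bar p)"
  have m: "?m \<in> EU_abs bar lam \<Lambda> n" using i gd' Lambda_conj by (simp add: long_transv_in_EU)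
  have s: "?s \<in> cent ?x"
    using commute_short_long[OF abs pq(1) gd(2) F i h(1) h'(1,2) i'] transv_in_EU[OF i h(1) h'(1,2)]
    by (simp add: mem_centr)
  have r: "?r \<in> cent ?x"
    using commute_short_long[OF abs form_idealD(5)[OF F(1) pq(1)] gd(2) F i mh h'(2,3) i']
      transv_in_EU[OF i mh h'(2,3)]
    by (simp add: mem_centr)
  have l: "?l \<in> cent ?x"
    using commute_long_nonopposite[OF h(1) i' h'(4)] long_transv_in_EU[OF h(1) gd'(1)] by (simp add: mem_centr)
  have "?s \<otimes>\<^bsub>G\<^esub> ?l = ?r \<otimes>\<^bsub>G\<^esub> ?m \<otimes>\<^bsub>G\<^esub> (?l \<otimes>\<^bsub>G\<^esub> ?s)"
    using transv_comm_short_long[OF i h(1) h'(1,2) twist_long_Lambda[OF Omega_nonzero[OF h(1)] gd'(1)], of p]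
    by (simp add: long_transv_def conj_twist)
  then have "?r \<otimes>\<^bsub>G\<^esub> ?m \<otimes>\<^bsub>G\<^esub> (?l \<otimes>\<^bsub>G\<^esub> ?s) \<in> cent ?x"
    using C.m_closed[OF s l] by metis
  moreover have "?r \<otimes>\<^bsub>G\<^esub> ?m \<in> carrier G"
    using group.subgroup_self[OF group_EU] subgroup.m_closed[of _ G] C.mem_carrier[OF r] m by fastforce
  ultimately have "?r \<otimes>\<^bsub>G\<^esub> ?m \<in> cent ?x"
    using subgroup_cancel_right[OF C.subgroup_axioms _ C.m_closed[OF l s]] by blast
  then have mC: "?m \<in> cent ?x"
    using subgroup_cancel_left[OF C.subgroup_axioms r, of ?m] m by simp
  let ?w = "p * g * bar q"
  let ?u = "q * g * bar q + (?w - lam * bar ?w)"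
  have "?w \<in> level"
    using abs form_idealD(5)[OF F(1) pq(1)] form_idealD(6)[OF F(2) pq(2)] by (simp add: absorbs_products_def)
  moreover have "q * g * bar q \<in> long_level"
    using abs gd pq by (simp add: absorbs_products_def)
  ultimately have "?u \<in> long_level"
    using add_subgroup_long_level level_trace[of ?w] by (simp add: add_subgroup_def)
  then have "long_transv n i ?u \<in> cent ?x"
    using i by (intro N_subset_centr[OF x]) (simp add: long_level_def)
  with mC have "?m \<otimes>\<^bsub>G\<^esub> long_transv n i ?u \<in> cent ?x"
    by (rule C.m_closed)
  then have "long_transv n i (p * g * bar p + ?u) \<in> cent ?x"
    using i by (simp add: long_transv_add)
  also have "p * g * bar p + ?u = g"
    using conj_partition[OF pq(3) gd'(1)] by (simp only: add.assoc)
  finally show ?thesis by (simp add: mem_centr)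
qed

lemma absorbs_gens_commute:
  assumes abs: "absorbs_products I \<Gamma> J \<Delta>"
    and F: "form_ideal bar lam \<Lambda> (I, \<Gamma>)" "form_ideal bar lam \<Lambda> (J, \<Delta>)" and IJ: "I + J = UNIV"
  shows "gens_commute I \<Gamma> J \<Delta>"
proof -
  obtain p q where pq: "p \<in> I" "q \<in> J" "p + q = 1"
    using IJ by (metis UNIV_I set_plus_elim)
  have ll: "long_transv n i g \<simeq> long_transv n k d"
    if "g \<in> \<Gamma>" "d \<in> \<Delta>" "i \<in> Omega n" "k \<in> Omega n" for i k g d
    using that commute_long_nonopposite[of i k] commute_long_opposite[OF abs _ _ F pq] by blast
  have ls: "long_transv n k g \<simeq> t i j b"
    if "b \<in> J" "g \<in> \<Gamma>" "i \<in> Omega n" "j \<in> Omega n" "i \<noteq> j" "i \<noteq> - j" "k \<in> Omega n" for i j k b g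
    using commute_short_long[OF absorbs_products_sym[OF abs] that(1,2) F(2,1) that(3-7)]
    by (simp add: commute_mod_sym)
  have gens_cases: thesis if "x \<in> elem_gens bar lam n (I, \<Gamma>)"
    "\<And>i j a. x = t i j a \<Longrightarrow> i \<in> Omega n \<Longrightarrow> j \<in> Omega n \<Longrightarrow> i \<noteq> j \<Longrightarrow> i \<noteq> - j \<Longrightarrow> a \<in> I \<Longrightarrow> thesis"
    "\<And>i g. x = long_transv n i g \<Longrightarrow> i \<in> Omega n \<Longrightarrow> g \<in> \<Gamma> \<Longrightarrow> thesis" for x I \<Gamma> thesis
    using that unfolding elem_gens_eq by blast
  have "x \<simeq> y" if x: "x \<in> elem_gens bar lam n (I, \<Gamma>)" and y: "y \<in> elem_gens bar lam n (J, \<Delta>)" for x y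
    using x
  proof (rule gens_cases)
    fix i j a assume x: "x = t i j a" "i \<in> Omega n" "j \<in> Omega n" "i \<noteq> j" "i \<noteq> - j" "a \<in> I"
    from y show ?thesis
      by (rule gens_cases) (use x commute_short_short[OF abs _ _ F pq] commute_short_long[OF abs _ _ F] in simp_all)
  next
    fix i g assume x: "x = long_transv n i g" "i \<in> Omega n" "g \<in> \<Gamma>"
    from y show ?thesis
      by (rule gens_cases) (use x ll ls in simp_all)
  qed
  then show ?thesis by (simp add: gens_commute_def)
qed

end

theorem theorem8:
  fixes bar :: "'a::{ring,monoid_mult} \<Rightarrow> 'a"
    and lam :: 'a
    and \<Lambda> I \<Gamma> J \<Delta> :: "'a set"
    and n :: nat
  assumes "form_ring bar lam \<Lambda>"
    and "n \<ge> 3"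
    and "form_ideal bar lam \<Lambda> (I, \<Gamma>)"
    and "form_ideal bar lam \<Lambda> (J, \<Delta>)"
    and "I + J = UNIV"
  shows "commutator_subgroup (GL n) (EU bar lam \<Lambda> n (I, \<Gamma>)) (EU bar lam \<Lambda> n (J, \<Delta>))
       = EU bar lam \<Lambda> n (symm_prod bar lam \<Lambda> (I, \<Gamma>) (J, \<Delta>))"
proof -
  interpret form_ring bar lam \<Lambda> by fact
  note F = assms(3,4)
  let ?Z = "elem_gens bar lam n (symm_prod bar lam \<Lambda> (I, \<Gamma>) (J, \<Delta>))"
  have EU_normal: "EU_normal bar lam \<Lambda> N n" if "N \<lhd> EU_group bar lam \<Lambda> n" for N
    using that assms(1,2) by (simp add: EU_normal_def EU_normal_axioms_def)
  have "snd (symm_prod bar lam \<Lambda> (I, \<Gamma>) (J, \<Delta>)) \<subseteq> \<Lambda>"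
    using EU_normal.symm_prod_gens_subset_iff(2)[OF EU_normal[OF group.normal_self[OF group_EU]] F] .
  then have Z: "?Z \<subseteq> EU_abs bar lam \<Lambda> n"
    using elem_gens_subset_EU_abs by (metis prod.collapse)
  show ?thesis
    unfolding EU_def
  proof (rule group.commutator_normal_closures_eq[OF group_GL subgroup_EU_abs _ _ Z generate_comaximal[OF F assms(5)]])
    fix N assume "N \<lhd> (GL n)\<lparr>carrier := EU_abs bar lam \<Lambda> n\<rparr>"
    then interpret EU_normal bar lam \<Lambda> N n
      by (intro EU_normal) (simp only: EU_group_def)
    show "?Z \<subseteq> N \<longleftrightarrow> (\<forall>x\<in>elem_gens bar lam n (I, \<Gamma>). \<forall>y\<in>elem_gens bar lam n (J, \<Delta>).
        commute_mod ((GL n)\<lparr>carrier := EU_abs bar lam \<Lambda> n\<rparr>) N x y)"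
      using symm_prod_gens_subset_iff(1)[OF F] gens_commute_absorbs[OF F] absorbs_gens_commute[OF _ F assms(5)]
      unfolding gens_commute_def EU_group_def by blast
  qed (use elem_gens_subset_EU_abs form_idealD(9) F in auto)
qed

end
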